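(* Let $M$ be a proper quasi bi-slant submanifold of a cosymplectic manifold $(\bar M,\varphi,\xi,\eta,g)$. Then $\mathcal{F}$ is parallel if and only if $\mathcal{B}$ is parallel.
   Context: An almost contact metric manifold $(\bar M,\varphi,\xi,\eta,g)$ is an odd-dimensional smooth manifold with a $(1,1)$-tensor $\varphi$, a vector field $\xi$, a 1-form $\eta$ and a Riemannian metric $g$ such that $\varphi^2=-I+\eta\otimes\xi$, $\varphi\xi=0$, $\eta\circ\varphi=0$, $\eta(\xi)=1$, $g(\varphi X,\varphi Y)=g(X,Y)-\eta(X)\eta(Y)$, $\eta(X)=g(X,\xi)$. It is cosymplectic if $\bar\nabla\varphi=0$, where $\bar\nabla$ is the Levi-Civita connection of $g$; then also $\bar\nabla\xi=0$. Let $M$ be a Riemannian manifold isometrically immersed in $\bar M$ (induced metric also denoted $g$). The induced connection $\nabla$, second fundamental form $h$, shape operators $\mathcal{A}_V$ and normal connection $\nabla^\perp$ are given by $\bar\nabla_XY=\nabla_XY+h(X,Y)$ and $\bar\nabla_XV=-\mathcal{A}_VX+\nabla^\perp_XV$ for $X,Y\in\Gamma(TM)$, $V\in\Gamma(T^\perp M)$. $M$ is a quasi bi-slant submanifold if $\xi$ is tangent to $M$ and there is an orthogonal decomposition $TM=\mathcal{D}\oplus\mathcal{D}_1\oplus\mathcal{D}_2\oplus\langle\xi\rangle$ into distributions such that: $\varphi\mathcal{D}=\mathcal{D}$; $\varphi\mathcal{D}_1\perp\mathcal{D}_2$ and $\varphi\mathcal{D}_2\perp\mathcal{D}_1$; and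 for $i=1,2$ the distribution $\mathcal{D}_i$ is slant with slant angle $\theta_i$, i.e. for every $p\in M$ and every nonzero $X\in(\mathcal{D}_i)_p$ the angle between $\varphi X$ and $(\mathcal{D}_i)_p$ equals the constant $\theta_i$. It is proper if $\mathcal{D},\mathcal{D}_1,\mathcal{D}_2$ all have nonzero rank and $\theta_1,\theta_2\notin\{0,\frac{\pi}{2}\}$. For $X\in\Gamma(TM)$ write $\varphi X=\mathcal{T}X+\mathcal{F}X$, and for $V\in\Gamma(T^\perp M)$ write $\varphi V=\mathcal{B}V+\mathcal{C}V$, where $\mathcal{T}X,\mathcal{B}V$ are tangent and $\mathcal{F}X,\mathcal{C}V$ are normal to $M$. For $Z_1,Z_2\in\Gamma(TM)$ and $W_1\in\Gamma(T^\perp M)$ define $(\bar\nabla_{Z_1}\mathcal{F})Z_2=\nabla^\perp_{Z_1}\mathcal{F}Z_2-\mathcal{F}\nabla_{Z_1}Z_2$ and $(\bar\nabla_{Z_1}\mathcal{B})W_1=\nabla_{Z_1}\mathcal{B}W_1-\mathcal{B}\nabla^\perp_{Z_1}W_1$. $\mathcal{F}$ is parallel if $\bar\nabla\mathcal{F}\equiv0$, and $\mathcal{B}$ is parallel if $\bar\nabla\mathcal{B}\equiv0$. *)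

theory Defs
  imports "HOL-Analysis.Analysis"
begin

section \<open>Smooth functions on open subsets of Euclidean space\<close>

text \<open>All sets to which these two notions are applied below are open.\<close>

primrec Ck_on :: "nat \<Rightarrow> 'a::euclidean_space set \<Rightarrow> ('a \<Rightarrow> 'b::real_normed_vector) \<Rightarrow> bool" where
  "Ck_on 0 S F \<longleftrightarrow> continuous_on S F"
| "Ck_on (Suc k) S F \<longleftrightarrow> (\<forall>x\<in>S. F differentiable at x) \<and>
     (\<forall>v. Ck_on k S (\<lambda>x. frechet_derivative F (at x) v))"

definition smooth_on :: "'a::euclidean_space set \<Rightarrow> ('a \<Rightarrow> 'b::real_normed_vector) \<Rightarrow> bool" where
  "smooth_on S F \<longleftrightarrow> (\<forall>k. Ck_on k S F)"


section \<open>Smooth manifolds\<close>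

text \<open>A manifold is a Hausdorff, second countable type \<open>'m\<close> with a smooth atlas modelled on
  a Euclidean space \<open>'a\<close>; its dimension is \<open>DIM('a)\<close>. A chart is a pair of a domain and a
  coordinate map, whose values outside the domain are irrelevant.\<close>

type_synonym ('m, 'a) chart = "'m set \<times> ('m \<Rightarrow> 'a)"

definition chart_inv :: "('m, 'a) chart \<Rightarrow> 'a \<Rightarrow> 'm" where
  "chart_inv c = inv_into (fst c) (snd c)"

definition smooth_atlas ::
  "('m::{t2_space, second_countable_topology}, 'a::euclidean_space) chart set \<Rightarrow> bool" where
  "smooth_atlas A \<longleftrightarrow>
     (\<Union>c\<in>A. fst c) = UNIV \<and>
     (\<forall>c\<in>A. open (fst c) \<and> open (snd c ` fst c) \<and>
        homeomorphism (fst c) (snd c ` fst c) (snd c) (chart_inv c)) \<and>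
     (\<forall>c\<in>A. \<forall>d\<in>A. smooth_on (snd c ` (fst c \<inter> fst d)) (snd d \<circ> chart_inv c))"

definition charts_at :: "('m, 'a) chart set \<Rightarrow> 'm \<Rightarrow> ('m, 'a) chart set" where
  "charts_at A p = {c \<in> A. p \<in> fst c}"

definition smooth_fun ::
  "('m::topological_space, 'a::euclidean_space) chart set \<Rightarrow> 'm set \<Rightarrow> ('m \<Rightarrow> real) \<Rightarrow> bool" where
  "smooth_fun A U h \<longleftrightarrow> (\<forall>c\<in>A. smooth_on (snd c ` (U \<inter> fst c)) (h \<circ> chart_inv c))"

definition smooth_map ::
  "('m::topological_space, 'a::euclidean_space) chart set \<Rightarrow>
   ('n::topological_space, 'b::euclidean_space) chart set \<Rightarrow> ('m \<Rightarrow> 'n) \<Rightarrow> bool" where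
  "smooth_map A B f \<longleftrightarrow> continuous_on UNIV f \<and>
     (\<forall>c\<in>A. \<forall>d\<in>B. smooth_on (snd c ` (fst c \<inter> f -` fst d)) (snd d \<circ> f \<circ> chart_inv c))"


section \<open>Tangent vectors\<close>

text \<open>A tangent vector at \<open>p\<close> is the family of its coordinate vectors in all charts around \<open>p\<close>,
  related by the derivatives of the coordinate changes (and 0 at the charts not around \<open>p\<close>). The
  type of all families of coordinate vectors is a copy of a function space, so as to carry the
  pointwise vector space structure.\<close>

typedef ('m, 'a) tvec = "UNIV :: (('m, 'a) chart \<Rightarrow> 'a) set"
  morphisms coord Tvec
  by simp

instantiation tvec :: (type, real_vector) real_vector
begin

definition "0 = Tvec (\<lambda>c. 0)"
definition "v + w = Tvec (\<lambda>c. coord v c + coord w c)"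
definition "v - w = Tvec (\<lambda>c. coord v c - coord w c)"
definition "- v = Tvec (\<lambda>c. - coord v c)"
definition "r *\<^sub>R v = Tvec (\<lambda>c. r *\<^sub>R coord v c)"

instance
  by standard
    (simp_all add: zero_tvec_def plus_tvec_def minus_tvec_def uminus_tvec_def scaleR_tvec_def
      Tvec_inverse Tvec_inject coord_inject coord_inverse algebra_simps)

end

definition tangent_space ::
  "('m, 'a::real_normed_vector) chart set \<Rightarrow> 'm \<Rightarrow> ('m, 'a) tvec set" where
  "tangent_space A p = {v.
     (\<forall>c\<in>charts_at A p. \<forall>d\<in>charts_at A p.
        coord v d = frechet_derivative (snd d \<circ> chart_inv c) (at (snd c p)) (coord v c)) \<and>
     (\<forall>c. c \<notin> charts_at A p \<longrightarrow> coord v c = 0)}"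

text \<open>The directional derivative of a function and the differential of a map; the result does not
  depend on the chosen chart.\<close>

definition dir_deriv ::
  "('m, 'a::real_normed_vector) chart set \<Rightarrow> 'm \<Rightarrow> ('m, 'a) tvec \<Rightarrow> ('m \<Rightarrow> real) \<Rightarrow> real" where
  "dir_deriv A p u h =
     (let c = (SOME c. c \<in> charts_at A p)
      in frechet_derivative (h \<circ> chart_inv c) (at (snd c p)) (coord u c))"

definition differential ::
  "('m, 'a::real_normed_vector) chart set \<Rightarrow> ('n, 'b::real_normed_vector) chart set \<Rightarrow>
   ('m \<Rightarrow> 'n) \<Rightarrow> 'm \<Rightarrow> ('m, 'a) tvec \<Rightarrow> ('n, 'b) tvec" where
  "differential A B f p u =
     (let c = (SOME c. c \<in> charts_at A p)
      in Tvec (\<lambda>d. if d \<in> charts_at B (f p)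
           then frechet_derivative (snd d \<circ> f \<circ> chart_inv c) (at (snd c p)) (coord u c)
           else 0))"


section \<open>Sections, vector fields and distributions\<close>

text \<open>Smooth sections over \<open>U\<close> of the pull-back of the tangent bundle of \<open>'n\<close> along
  \<open>f :: 'm \<Rightarrow> 'n\<close>. The values of \<open>W\<close> outside \<open>U\<close> are irrelevant.\<close>

definition smooth_section ::
  "('m::topological_space, 'a::euclidean_space) chart set \<Rightarrow>
   ('n::topological_space, 'b::euclidean_space) chart set \<Rightarrow>
   ('m \<Rightarrow> 'n) \<Rightarrow> 'm set \<Rightarrow> ('m \<Rightarrow> ('n, 'b) tvec) \<Rightarrow> bool" where
  "smooth_section A B f U W \<longleftrightarrow>
     (\<forall>q\<in>U. W q \<in> tangent_space B (f q)) \<and>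
     (\<forall>c\<in>A. \<forall>d\<in>B. smooth_on (snd c ` (U \<inter> fst c \<inter> f -` fst d)) (\<lambda>x. coord (W (chart_inv c x)) d))"

abbreviation smooth_field ::
  "('m::topological_space, 'a::euclidean_space) chart set \<Rightarrow> 'm set \<Rightarrow>
   ('m \<Rightarrow> ('m, 'a) tvec) \<Rightarrow> bool" where
  "smooth_field A U X \<equiv> smooth_section A A id U X"

text \<open>In a chart, \<open>[X, Y] = DY(X) - DX(Y)\<close>.\<close>

definition lie_bracket ::
  "('m, 'a::real_normed_vector) chart set \<Rightarrow> ('m \<Rightarrow> ('m, 'a) tvec) \<Rightarrow> ('m \<Rightarrow> ('m, 'a) tvec) \<Rightarrow>
   'm \<Rightarrow> ('m, 'a) tvec" where
  "lie_bracket A X Y p = Tvec (\<lambda>c. if c \<in> charts_at A p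
     then frechet_derivative (\<lambda>x. coord (Y (chart_inv c x)) c) (at (snd c p)) (coord (X p) c)
        - frechet_derivative (\<lambda>x. coord (X (chart_inv c x)) c) (at (snd c p)) (coord (Y p) c)
     else 0)"

definition distribution ::
  "('m::topological_space, 'a::euclidean_space) chart set \<Rightarrow> nat \<Rightarrow>
   ('m \<Rightarrow> ('m, 'a) tvec set) \<Rightarrow> bool" where
  "distribution A k \<Delta> \<longleftrightarrow>
     (\<forall>p. \<exists>U (X :: nat \<Rightarrow> 'm \<Rightarrow> ('m, 'a) tvec). open U \<and> p \<in> U \<and> (\<forall>i<k. smooth_field A U (X i)) \<and>
        (\<forall>q\<in>U. \<Delta> q = span ((\<lambda>i. X i q) ` {..<k}) \<and> dim (\<Delta> q) = k))"


section \<open>Riemannian metrics and connections\<close>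

definition linear_between ::
  "'v::real_vector set \<Rightarrow> 'w::real_vector set \<Rightarrow> ('v \<Rightarrow> 'w) \<Rightarrow> bool" where
  "linear_between S T L \<longleftrightarrow> (\<forall>x\<in>S. L x \<in> T) \<and>
     (\<forall>x\<in>S. \<forall>y\<in>S. L (x + y) = L x + L y) \<and> (\<forall>x\<in>S. \<forall>r. L (r *\<^sub>R x) = r *\<^sub>R L x)"

definition riemannian_metric ::
  "('m::topological_space, 'a::euclidean_space) chart set \<Rightarrow>
   ('m \<Rightarrow> ('m, 'a) tvec \<Rightarrow> ('m, 'a) tvec \<Rightarrow> real) \<Rightarrow> bool" where
  "riemannian_metric A g \<longleftrightarrow>
     (\<forall>p. (\<forall>u\<in>tangent_space A p. linear_between (tangent_space A p) UNIV (g p u)) \<and>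
        (\<forall>u\<in>tangent_space A p. \<forall>v\<in>tangent_space A p. g p u v = g p v u) \<and>
        (\<forall>u\<in>tangent_space A p. u \<noteq> 0 \<longrightarrow> g p u u > 0)) \<and>
     (\<forall>U X Y. open U \<and> smooth_field A U X \<and> smooth_field A U Y \<longrightarrow>
        smooth_fun A U (\<lambda>q. g q (X q) (Y q)))"

text \<open>Linear connections on the pull-back of the tangent bundle of \<open>'n\<close> along a smooth map
  \<open>f :: 'm \<Rightarrow> 'n\<close>: \<open>N p u W\<close> is the covariant derivative at \<open>p\<close> of a section \<open>W\<close>, defined
  and smooth near \<open>p\<close>, in the direction of a tangent vector \<open>u\<close> at \<open>p\<close>. The Leibniz rule for
  functions defined near \<open>p\<close> only makes \<open>N p u W\<close> depend only on the germ of \<open>W\<close> at \<open>p\<close>.\<close>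

definition connection_along ::
  "('m::topological_space, 'a::euclidean_space) chart set \<Rightarrow>
   ('n::topological_space, 'b::euclidean_space) chart set \<Rightarrow> ('m \<Rightarrow> 'n) \<Rightarrow>
   ('m \<Rightarrow> ('m, 'a) tvec \<Rightarrow> ('m \<Rightarrow> ('n, 'b) tvec) \<Rightarrow> ('n, 'b) tvec) \<Rightarrow> bool" where
  "connection_along A B f N \<longleftrightarrow>
     (\<forall>U W p. open U \<and> p \<in> U \<and> smooth_section A B f U W \<longrightarrow>
        linear_between (tangent_space A p) (tangent_space B (f p)) (\<lambda>u. N p u W)) \<and>
     (\<forall>U V W p. \<forall>u\<in>tangent_space A p.
        open U \<and> p \<in> U \<and> smooth_section A B f U V \<and> smooth_section A B f U W \<longrightarrow>
        N p u (\<lambda>q. V q + W q) = N p u V + N p u W) \<and>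
     (\<forall>U h W p. \<forall>u\<in>tangent_space A p.
        open U \<and> p \<in> U \<and> smooth_fun A U h \<and> smooth_section A B f U W \<longrightarrow>
        N p u (\<lambda>q. h q *\<^sub>R W q) = dir_deriv A p u h *\<^sub>R W p + h p *\<^sub>R N p u W) \<and>
     (\<forall>U X W. open U \<and> smooth_field A U X \<and> smooth_section A B f U W \<longrightarrow>
        smooth_section A B f U (\<lambda>q. N q (X q) W))"

definition levi_civita ::
  "('m::topological_space, 'a::euclidean_space) chart set \<Rightarrow>
   ('m \<Rightarrow> ('m, 'a) tvec \<Rightarrow> ('m, 'a) tvec \<Rightarrow> real) \<Rightarrow>
   ('m \<Rightarrow> ('m, 'a) tvec \<Rightarrow> ('m \<Rightarrow> ('m, 'a) tvec) \<Rightarrow> ('m, 'a) tvec) \<Rightarrow> bool" where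
  "levi_civita A g N \<longleftrightarrow> connection_along A A id N \<and>
     (\<forall>U X Y p. open U \<and> p \<in> U \<and> smooth_field A U X \<and> smooth_field A U Y \<longrightarrow>
        N p (X p) Y - N p (Y p) X = lie_bracket A X Y p) \<and>
     (\<forall>U X Y p. \<forall>u\<in>tangent_space A p.
        open U \<and> p \<in> U \<and> smooth_field A U X \<and> smooth_field A U Y \<longrightarrow>
        dir_deriv A p u (\<lambda>q. g q (X q) (Y q)) = g p (N p u X) (Y p) + g p (X p) (N p u Y))"

text \<open>The connection induced along \<open>f\<close> by a connection \<open>N\<close> on \<open>'n\<close>. It gives a meaning
  to the ambient covariant derivative, along a submanifold, of ambient fields that are defined only
  on the submanifold.\<close>

definition pullback_connection ::
  "('m::topological_space, 'a::euclidean_space) chart set \<Rightarrow>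
   ('n::topological_space, 'b::euclidean_space) chart set \<Rightarrow> ('m \<Rightarrow> 'n) \<Rightarrow>
   ('n \<Rightarrow> ('n, 'b) tvec \<Rightarrow> ('n \<Rightarrow> ('n, 'b) tvec) \<Rightarrow> ('n, 'b) tvec) \<Rightarrow>
   ('m \<Rightarrow> ('m, 'a) tvec \<Rightarrow> ('m \<Rightarrow> ('n, 'b) tvec) \<Rightarrow> ('n, 'b) tvec) \<Rightarrow> bool" where
  "pullback_connection A B f N D \<longleftrightarrow> connection_along A B f D \<and>
     (\<forall>V Y p. \<forall>u\<in>tangent_space A p. open V \<and> f p \<in> V \<and> smooth_field B V Y \<longrightarrow>
        D p u (Y \<circ> f) = N (f p) (differential A B f p u) Y)"


section \<open>Almost contact metric and cosymplectic manifolds\<close>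

definition almost_contact_metric ::
  "('n::topological_space, 'b::euclidean_space) chart set \<Rightarrow>
   ('n \<Rightarrow> ('n, 'b) tvec \<Rightarrow> ('n, 'b) tvec) \<Rightarrow> ('n \<Rightarrow> ('n, 'b) tvec) \<Rightarrow> ('n \<Rightarrow> ('n, 'b) tvec \<Rightarrow> real) \<Rightarrow>
   ('n \<Rightarrow> ('n, 'b) tvec \<Rightarrow> ('n, 'b) tvec \<Rightarrow> real) \<Rightarrow> bool" where
  "almost_contact_metric B \<phi> \<xi> \<eta> g \<longleftrightarrow>
     odd DIM('b) \<and> riemannian_metric B g \<and> smooth_field B UNIV \<xi> \<and>
     (\<forall>p. linear_between (tangent_space B p) (tangent_space B p) (\<phi> p)) \<and>
     (\<forall>U X. open U \<and> smooth_field B U X \<longrightarrow> smooth_field B U (\<lambda>q. \<phi> q (X q))) \<and>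
     (\<forall>p. linear_between (tangent_space B p) UNIV (\<eta> p)) \<and>
     (\<forall>U X. open U \<and> smooth_field B U X \<longrightarrow> smooth_fun B U (\<lambda>q. \<eta> q (X q))) \<and>
     (\<forall>p. \<phi> p (\<xi> p) = 0 \<and> \<eta> p (\<xi> p) = 1) \<and>
     (\<forall>p. \<forall>u\<in>tangent_space B p.
        \<phi> p (\<phi> p u) = - u + \<eta> p u *\<^sub>R \<xi> p \<and> \<eta> p (\<phi> p u) = 0 \<and> \<eta> p u = g p u (\<xi> p)) \<and>
     (\<forall>p. \<forall>u\<in>tangent_space B p. \<forall>v\<in>tangent_space B p.
        g p (\<phi> p u) (\<phi> p v) = g p u v - \<eta> p u * \<eta> p v)"

text \<open>\<open>N\<close> is the Levi-Civita connection, and \<open>\<phi>\<close> is parallel for it.\<close>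

definition cosymplectic ::
  "('n::topological_space, 'b::euclidean_space) chart set \<Rightarrow>
   ('n \<Rightarrow> ('n, 'b) tvec \<Rightarrow> ('n, 'b) tvec) \<Rightarrow> ('n \<Rightarrow> ('n, 'b) tvec) \<Rightarrow> ('n \<Rightarrow> ('n, 'b) tvec \<Rightarrow> real) \<Rightarrow>
   ('n \<Rightarrow> ('n, 'b) tvec \<Rightarrow> ('n, 'b) tvec \<Rightarrow> real) \<Rightarrow>
   ('n \<Rightarrow> ('n, 'b) tvec \<Rightarrow> ('n \<Rightarrow> ('n, 'b) tvec) \<Rightarrow> ('n, 'b) tvec) \<Rightarrow> bool" where
  "cosymplectic B \<phi> \<xi> \<eta> g N \<longleftrightarrow> almost_contact_metric B \<phi> \<xi> \<eta> g \<and> levi_civita B g N \<and>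
     (\<forall>U Y p. \<forall>u\<in>tangent_space B p. open U \<and> p \<in> U \<and> smooth_field B U Y \<longrightarrow>
        N p u (\<lambda>q. \<phi> q (Y q)) - \<phi> p (N p u Y) = 0)"


section \<open>Submanifolds\<close>

definition isometric_immersion ::
  "('m::topological_space, 'a::euclidean_space) chart set \<Rightarrow>
   ('n::topological_space, 'b::euclidean_space) chart set \<Rightarrow> ('m \<Rightarrow> 'n) \<Rightarrow>
   ('m \<Rightarrow> ('m, 'a) tvec \<Rightarrow> ('m, 'a) tvec \<Rightarrow> real) \<Rightarrow>
   ('n \<Rightarrow> ('n, 'b) tvec \<Rightarrow> ('n, 'b) tvec \<Rightarrow> real) \<Rightarrow> bool" where
  "isometric_immersion A B f gM g \<longleftrightarrow> smooth_map A B f \<and>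
     (\<forall>p. inj_on (differential A B f p) (tangent_space A p)) \<and>
     (\<forall>p. \<forall>u\<in>tangent_space A p. \<forall>v\<in>tangent_space A p.
        g (f p) (differential A B f p u) (differential A B f p v) = gM p u v)"

definition normal_space ::
  "('m, 'a::real_normed_vector) chart set \<Rightarrow> ('n, 'b::real_normed_vector) chart set \<Rightarrow> ('m \<Rightarrow> 'n) \<Rightarrow>
   ('n \<Rightarrow> ('n, 'b) tvec \<Rightarrow> ('n, 'b) tvec \<Rightarrow> real) \<Rightarrow> 'm \<Rightarrow> ('n, 'b) tvec set" where
  "normal_space A B f g p = {w \<in> tangent_space B (f p).
     \<forall>u\<in>tangent_space A p. g (f p) w (differential A B f p u) = 0}"

text \<open>\<open>w = df(tan_part w) + nor_part w\<close>: the tangential part is taken as a tangent vector of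
  the submanifold itself, the normal part as an ambient tangent vector.\<close>

definition tan_part ::
  "('m, 'a::real_normed_vector) chart set \<Rightarrow> ('n, 'b::real_normed_vector) chart set \<Rightarrow> ('m \<Rightarrow> 'n) \<Rightarrow>
   ('n \<Rightarrow> ('n, 'b) tvec \<Rightarrow> ('n, 'b) tvec \<Rightarrow> real) \<Rightarrow> 'm \<Rightarrow> ('n, 'b) tvec \<Rightarrow> ('m, 'a) tvec" where
  "tan_part A B f g p w =
     (THE u. u \<in> tangent_space A p \<and> w - differential A B f p u \<in> normal_space A B f g p)"

definition nor_part ::
  "('m, 'a::real_normed_vector) chart set \<Rightarrow> ('n, 'b::real_normed_vector) chart set \<Rightarrow> ('m \<Rightarrow> 'n) \<Rightarrow>
   ('n \<Rightarrow> ('n, 'b) tvec \<Rightarrow> ('n, 'b) tvec \<Rightarrow> real) \<Rightarrow> 'm \<Rightarrow> ('n, 'b) tvec \<Rightarrow> ('n, 'b) tvec" where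
  "nor_part A B f g p w = w - differential A B f p (tan_part A B f g p w)"

definition normal_section ::
  "('m::topological_space, 'a::euclidean_space) chart set \<Rightarrow>
   ('n::topological_space, 'b::euclidean_space) chart set \<Rightarrow> ('m \<Rightarrow> 'n) \<Rightarrow>
   ('n \<Rightarrow> ('n, 'b) tvec \<Rightarrow> ('n, 'b) tvec \<Rightarrow> real) \<Rightarrow> ('m \<Rightarrow> ('n, 'b) tvec) \<Rightarrow> bool" where
  "normal_section A B f g V \<longleftrightarrow> smooth_section A B f UNIV V \<and> (\<forall>p. V p \<in> normal_space A B f g p)"

text \<open>Below, \<open>D\<close> is the pull-back along \<open>f\<close> of the ambient Levi-Civita connection. The first
  two definitions are the Gauss and Weingarten decompositions.\<close>

definition induced_connection ::
  "('m, 'a::real_normed_vector) chart set \<Rightarrow> ('n, 'b::real_normed_vector) chart set \<Rightarrow> ('m \<Rightarrow> 'n) \<Rightarrow>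
   ('n \<Rightarrow> ('n, 'b) tvec \<Rightarrow> ('n, 'b) tvec \<Rightarrow> real) \<Rightarrow>
   ('m \<Rightarrow> ('m, 'a) tvec \<Rightarrow> ('m \<Rightarrow> ('n, 'b) tvec) \<Rightarrow> ('n, 'b) tvec) \<Rightarrow>
   'm \<Rightarrow> ('m, 'a) tvec \<Rightarrow> ('m \<Rightarrow> ('m, 'a) tvec) \<Rightarrow> ('m, 'a) tvec" where
  "induced_connection A B f g D p u Y =
     tan_part A B f g p (D p u (\<lambda>q. differential A B f q (Y q)))"

definition normal_connection ::
  "('m, 'a::real_normed_vector) chart set \<Rightarrow> ('n, 'b::real_normed_vector) chart set \<Rightarrow> ('m \<Rightarrow> 'n) \<Rightarrow>
   ('n \<Rightarrow> ('n, 'b) tvec \<Rightarrow> ('n, 'b) tvec \<Rightarrow> real) \<Rightarrow>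
   ('m \<Rightarrow> ('m, 'a) tvec \<Rightarrow> ('m \<Rightarrow> ('n, 'b) tvec) \<Rightarrow> ('n, 'b) tvec) \<Rightarrow>
   'm \<Rightarrow> ('m, 'a) tvec \<Rightarrow> ('m \<Rightarrow> ('n, 'b) tvec) \<Rightarrow> ('n, 'b) tvec" where
  "normal_connection A B f g D p u V = nor_part A B f g p (D p u V)"

definition F_op ::
  "('m, 'a::real_normed_vector) chart set \<Rightarrow> ('n, 'b::real_normed_vector) chart set \<Rightarrow> ('m \<Rightarrow> 'n) \<Rightarrow>
   ('n \<Rightarrow> ('n, 'b) tvec \<Rightarrow> ('n, 'b) tvec) \<Rightarrow> ('n \<Rightarrow> ('n, 'b) tvec \<Rightarrow> ('n, 'b) tvec \<Rightarrow> real) \<Rightarrow>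
   'm \<Rightarrow> ('m, 'a) tvec \<Rightarrow> ('n, 'b) tvec" where
  "F_op A B f \<phi> g p u = nor_part A B f g p (\<phi> (f p) (differential A B f p u))"

definition B_op ::
  "('m, 'a::real_normed_vector) chart set \<Rightarrow> ('n, 'b::real_normed_vector) chart set \<Rightarrow> ('m \<Rightarrow> 'n) \<Rightarrow>
   ('n \<Rightarrow> ('n, 'b) tvec \<Rightarrow> ('n, 'b) tvec) \<Rightarrow> ('n \<Rightarrow> ('n, 'b) tvec \<Rightarrow> ('n, 'b) tvec \<Rightarrow> real) \<Rightarrow>
   'm \<Rightarrow> ('n, 'b) tvec \<Rightarrow> ('m, 'a) tvec" where
  "B_op A B f \<phi> g p V = tan_part A B f g p (\<phi> (f p) V)"

definition F_parallel ::
  "('m::topological_space, 'a::euclidean_space) chart set \<Rightarrow>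
   ('n::topological_space, 'b::euclidean_space) chart set \<Rightarrow> ('m \<Rightarrow> 'n) \<Rightarrow>
   ('n \<Rightarrow> ('n, 'b) tvec \<Rightarrow> ('n, 'b) tvec) \<Rightarrow> ('n \<Rightarrow> ('n, 'b) tvec \<Rightarrow> ('n, 'b) tvec \<Rightarrow> real) \<Rightarrow>
   ('m \<Rightarrow> ('m, 'a) tvec \<Rightarrow> ('m \<Rightarrow> ('n, 'b) tvec) \<Rightarrow> ('n, 'b) tvec) \<Rightarrow> bool" where
  "F_parallel A B f \<phi> g D \<longleftrightarrow>
     (\<forall>Z1 Z2. smooth_field A UNIV Z1 \<and> smooth_field A UNIV Z2 \<longrightarrow>
        (\<forall>p. normal_connection A B f g D p (Z1 p) (\<lambda>q. F_op A B f \<phi> g q (Z2 q))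
           - F_op A B f \<phi> g p (induced_connection A B f g D p (Z1 p) Z2) = 0))"

definition B_parallel ::
  "('m::topological_space, 'a::euclidean_space) chart set \<Rightarrow>
   ('n::topological_space, 'b::euclidean_space) chart set \<Rightarrow> ('m \<Rightarrow> 'n) \<Rightarrow>
   ('n \<Rightarrow> ('n, 'b) tvec \<Rightarrow> ('n, 'b) tvec) \<Rightarrow> ('n \<Rightarrow> ('n, 'b) tvec \<Rightarrow> ('n, 'b) tvec \<Rightarrow> real) \<Rightarrow>
   ('m \<Rightarrow> ('m, 'a) tvec \<Rightarrow> ('m \<Rightarrow> ('n, 'b) tvec) \<Rightarrow> ('n, 'b) tvec) \<Rightarrow> bool" where
  "B_parallel A B f \<phi> g D \<longleftrightarrow>
     (\<forall>Z1 W1. smooth_field A UNIV Z1 \<and> normal_section A B f g W1 \<longrightarrow>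
        (\<forall>p. induced_connection A B f g D p (Z1 p) (\<lambda>q. B_op A B f \<phi> g q (W1 q))
           - B_op A B f \<phi> g p (normal_connection A B f g D p (Z1 p) W1) = 0))"


section \<open>Quasi bi-slant submanifolds\<close>

definition vector_angle :: "('v \<Rightarrow> 'v \<Rightarrow> real) \<Rightarrow> 'v \<Rightarrow> 'v \<Rightarrow> real" where
  "vector_angle b v w = arccos (b v w / (sqrt (b v v) * sqrt (b w w)))"

text \<open>The angle between a vector and a subspace is the least angle to a nonzero vector of the
  subspace.\<close>

definition subspace_angle :: "('v \<Rightarrow> 'v \<Rightarrow> real) \<Rightarrow> 'v \<Rightarrow> 'v::zero set \<Rightarrow> real" where
  "subspace_angle b v S = (INF w\<in>S - {0}. vector_angle b v w)"

definition slant ::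
  "('m, 'a::real_normed_vector) chart set \<Rightarrow> ('n, 'b::real_normed_vector) chart set \<Rightarrow> ('m \<Rightarrow> 'n) \<Rightarrow>
   ('n \<Rightarrow> ('n, 'b) tvec \<Rightarrow> ('n, 'b) tvec) \<Rightarrow> ('n \<Rightarrow> ('n, 'b) tvec \<Rightarrow> ('n, 'b) tvec \<Rightarrow> real) \<Rightarrow>
   ('m \<Rightarrow> ('m, 'a) tvec set) \<Rightarrow> real \<Rightarrow> bool" where
  "slant A B f \<phi> g \<Delta> \<theta> \<longleftrightarrow>
     (\<forall>p. \<forall>u\<in>\<Delta> p. u \<noteq> 0 \<longrightarrow>
        subspace_angle (g (f p)) (\<phi> (f p) (differential A B f p u)) (differential A B f p ` \<Delta> p) = \<theta>)"

text \<open>\<open>k0, k1, k2\<close> are the ranks of the distributions. The sum of the four pieces is direct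
  because they are mutually orthogonal.\<close>

definition quasi_bi_slant ::
  "('m::topological_space, 'a::euclidean_space) chart set \<Rightarrow>
   ('n::topological_space, 'b::euclidean_space) chart set \<Rightarrow> ('m \<Rightarrow> 'n) \<Rightarrow>
   ('n \<Rightarrow> ('n, 'b) tvec \<Rightarrow> ('n, 'b) tvec) \<Rightarrow> ('n \<Rightarrow> ('n, 'b) tvec) \<Rightarrow>
   ('n \<Rightarrow> ('n, 'b) tvec \<Rightarrow> ('n, 'b) tvec \<Rightarrow> real) \<Rightarrow>
   ('m \<Rightarrow> ('m, 'a) tvec set) \<Rightarrow> ('m \<Rightarrow> ('m, 'a) tvec set) \<Rightarrow> ('m \<Rightarrow> ('m, 'a) tvec set) \<Rightarrow>
   nat \<Rightarrow> nat \<Rightarrow> nat \<Rightarrow> real \<Rightarrow> real \<Rightarrow> bool" where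
  "quasi_bi_slant A B f \<phi> \<xi> g \<Delta> \<Delta>1 \<Delta>2 k0 k1 k2 \<theta>1 \<theta>2 \<longleftrightarrow>
     distribution A k0 \<Delta> \<and> distribution A k1 \<Delta>1 \<and> distribution A k2 \<Delta>2 \<and>
     (\<forall>p. let df = differential A B f p; G = g (f p); \<Phi> = \<phi> (f p);
              L = {u \<in> tangent_space A p. df u \<in> span {\<xi> (f p)}};
              orth = (\<lambda>S T. \<forall>x\<in>S. \<forall>y\<in>T. G x y = 0)
          in \<xi> (f p) \<in> df ` tangent_space A p \<and>
             tangent_space A p = {a + b + c + e | a b c e. a \<in> \<Delta> p \<and> b \<in> \<Delta>1 p \<and> c \<in> \<Delta>2 p \<and> e \<in> L} \<and>
             orth (df ` \<Delta> p) (df ` \<Delta>1 p) \<and> orth (df ` \<Delta> p) (df ` \<Delta>2 p) \<and>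
             orth (df ` \<Delta>1 p) (df ` \<Delta>2 p) \<and> orth (df ` \<Delta> p) (df ` L) \<and>
             orth (df ` \<Delta>1 p) (df ` L) \<and> orth (df ` \<Delta>2 p) (df ` L) \<and>
             \<Phi> ` df ` \<Delta> p = df ` \<Delta> p \<and>
             orth (\<Phi> ` df ` \<Delta>1 p) (df ` \<Delta>2 p) \<and> orth (\<Phi> ` df ` \<Delta>2 p) (df ` \<Delta>1 p)) \<and>
     slant A B f \<phi> g \<Delta>1 \<theta>1 \<and> slant A B f \<phi> g \<Delta>2 \<theta>2"

definition proper_quasi_bi_slant ::
  "('m::topological_space, 'a::euclidean_space) chart set \<Rightarrow>
   ('n::topological_space, 'b::euclidean_space) chart set \<Rightarrow> ('m \<Rightarrow> 'n) \<Rightarrow>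
   ('n \<Rightarrow> ('n, 'b) tvec \<Rightarrow> ('n, 'b) tvec) \<Rightarrow> ('n \<Rightarrow> ('n, 'b) tvec) \<Rightarrow>
   ('n \<Rightarrow> ('n, 'b) tvec \<Rightarrow> ('n, 'b) tvec \<Rightarrow> real) \<Rightarrow> bool" where
  "proper_quasi_bi_slant A B f \<phi> \<xi> g \<longleftrightarrow>
     (\<exists>\<Delta> \<Delta>1 \<Delta>2 k0 k1 k2 \<theta>1 \<theta>2. quasi_bi_slant A B f \<phi> \<xi> g \<Delta> \<Delta>1 \<Delta>2 k0 k1 k2 \<theta>1 \<theta>2 \<and>
        k0 \<noteq> 0 \<and> k1 \<noteq> 0 \<and> k2 \<noteq> 0 \<and> \<theta>1 \<notin> {0, pi/2} \<and> \<theta>2 \<notin> {0, pi/2})"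

end

(*
  Writing the decomposition of the tangent vectors along the submanifold as phi X = T X + F X and
  phi V = B V + C V, skew-symmetry of phi gives g (F Z, W) = - g (Z, B W) for Z tangent and W
  normal. Differentiating this identity along the submanifold with the metric pull-back connection
  yields g ((D F) Z, W) = - g (Z, (D B) W). So each covariant derivative vanishes if and only if the
  other does, provided that every tangent or normal vector at a point extends to a global smooth
  tangent or normal field; this is achieved with bump functions and with the smoothness of the
  tangential projection, read off from an orthogonal frame.
*)
theory Submission
  imports Defs "HOL-Computational_Algebra.Polynomial"
begin

section \<open>Calculus of smooth functions\<close>

text \<open>The difficulty lies between the pointwise algebra and the analytic definitions.
  \<open>tan_part\<close> is a definite description, so neither existence nor smoothness of the
  projection is given, and without smoothness of \<open>F_op\<close> and \<open>B_op\<close> applied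
  to fields no rule for the connection may be used on them. An orthogonal frame of the submanifold
  turns the projection into quotients of inner products, which settles both questions. A second gap
  concerns the connection: the pull-back is tied to the Levi-Civita connection only on sections of
  the form \<open>Y \<circ> f\<close>, and a general section along \<open>f\<close> is not of this
  form. Metric compatibility therefore has to be rebuilt from coordinate fields, which form a frame
  over a chart domain only. This works because a connection sees only the germ of a section,
  although its argument is a function on the whole manifold.\<close>

lemma Ck_on_subset: "Ck_on k S F \<Longrightarrow> T \<subseteq> S \<Longrightarrow> Ck_on k T F"
  by (induction k arbitrary: F) (auto intro: continuous_on_subset)

text \<open>Openness matters here: the derivatives are taken in the whole space, so \<open>F\<close>
  and \<open>G\<close> have to agree on a neighbourhood of each point.\<close>

lemma Ck_on_cong:
  assumes "open S" "Ck_on k S F" "\<And>x. x \<in> S \<Longrightarrow> F x = G x"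
  shows "Ck_on k S G"
  using assms(2,3)
proof (induction k arbitrary: F G)
  case 0
  then show ?case by (auto cong: continuous_on_cong)
next
  case (Suc k)
  have D: "(G has_derivative frechet_derivative F (at x)) (at x)" if "x \<in> S" for x
    using Suc.prems that assms(1) has_derivative_transform_within_open[of F _ x UNIV S G]
    by (auto simp: frechet_derivative_works)
  show ?case
    unfolding Ck_on.simps
  proof (intro conjI ballI allI)
    fix x assume "x \<in> S" then show "G differentiable at x"
      using D differentiableI by blast
  next
    fix v
    show "Ck_on k S (\<lambda>x. frechet_derivative G (at x) v)"
    proof (rule Suc.IH)
      show "Ck_on k S (\<lambda>x. frechet_derivative F (at x) v)"
        using Suc.prems(1) by simp
    qed (use D frechet_derivative_at in metis)
  qed
qed

text \<open>Any explicit derivative may be supplied in place of \<open>frechet_derivative\<close>;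
  the closure rules below are inductions on the order in which this rule performs the step.\<close>

lemma Ck_on_SucI:
  assumes "open S" "\<And>x. x \<in> S \<Longrightarrow> (F has_derivative F' x) (at x)"
    "\<And>v. Ck_on k S (\<lambda>x. F' x v)"
  shows "Ck_on (Suc k) S F"
  unfolding Ck_on.simps
proof (intro conjI ballI allI)
  fix v
  show "Ck_on k S (\<lambda>x. frechet_derivative F (at x) v)"
    by (rule Ck_on_cong[OF assms(1) assms(3)[of v]]) (metis assms(2) frechet_derivative_at)
qed (use assms(2) differentiableI in blast)

text \<open>All clauses are conditions at single points, and continuity on an open set is continuity
  at its points. Hence \<open>S\<close> need not be open and \<open>T\<close> need not lie inside
  \<open>S\<close>.\<close>

lemma Ck_on_local:
  assumes "\<And>x. x \<in> S \<Longrightarrow> \<exists>T. open T \<and> x \<in> T \<and> Ck_on k T F"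
  shows "Ck_on k S F"
  using assms
proof (induction k arbitrary: F)
  case 0
  then show ?case
    by (metis Ck_on.simps(1) continuous_at_imp_continuous_on continuous_on_eq_continuous_at)
next
  case (Suc k)
  show ?case
    unfolding Ck_on.simps
  proof (intro conjI ballI allI)
    fix x assume "x \<in> S" then show "F differentiable at x"
      using Suc.prems[of x] by auto
  next
    fix v
    show "Ck_on k S (\<lambda>x. frechet_derivative F (at x) v)"
    proof (rule Suc.IH)
      fix x assume "x \<in> S"
      then show "\<exists>T. open T \<and> x \<in> T \<and> Ck_on k T (\<lambda>x. frechet_derivative F (at x) v)"
        using Suc.prems[of x] by auto
    qed
  qed
qed

lemma Ck_on_imp_continuous_on: "Ck_on k S F \<Longrightarrow> continuous_on S F"
  by (cases k) (simp_all add: continuous_at_imp_continuous_on differentiable_imp_continuous_within)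

text \<open>The recursion removes the innermost derivative first, so lowering the order is an
  induction: differentiability gives continuity at the bottom, and the induction hypothesis is
  applied to the directional derivatives above it.\<close>

lemma Ck_on_SucD: "Ck_on (Suc k) S F \<Longrightarrow> Ck_on k S F"
proof (induction k arbitrary: F)
  case 0
  then show ?case using Ck_on_imp_continuous_on[OF 0] by simp
next
  case (Suc k)
  then have "\<forall>x\<in>S. F differentiable at x" "Ck_on (Suc k) S (\<lambda>x. frechet_derivative F (at x) v)" for v
    by auto
  then show ?case using Suc.IH unfolding Ck_on.simps(2)[of k S F] by blast
qed

lemma Ck_on_const: "open S \<Longrightarrow> Ck_on k S (\<lambda>x. c)"
proof (induction k arbitrary: c)
  case (Suc k)
  then show ?case by (intro Ck_on_SucI[where F' = "\<lambda>_ _. 0"]) auto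
qed simp

lemma Ck_on_linear:
  assumes "bounded_linear L" "open S" shows "Ck_on k S L"
proof (cases k)
  case 0
  then show ?thesis
    using assms by (simp add: linear_continuous_on)
next
  case (Suc j)
  show ?thesis
    unfolding Suc
    by (rule Ck_on_SucI[OF assms(2), where F' = "\<lambda>_. L"])
      (simp_all add: assms bounded_linear_imp_has_derivative Ck_on_const)
qed

lemma Ck_on_add:
  assumes "open S" "Ck_on k S F" "Ck_on k S G"
  shows "Ck_on k S (\<lambda>x. F x + G x)"
  using assms(2,3)
proof (induction k arbitrary: F G)
  case (Suc k)
  then show ?case
    by (intro Ck_on_SucI[OF assms(1),
          where F' = "\<lambda>x v. frechet_derivative F (at x) v + frechet_derivative G (at x) v"])
      (auto intro!: has_derivative_add simp: frechet_derivative_works)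
qed (auto intro: continuous_on_add)

lemma Ck_on_sum:
  assumes "open S" "\<And>i. i \<in> I \<Longrightarrow> Ck_on k S (F i)"
  shows "Ck_on k S (\<lambda>x. \<Sum>i\<in>I. F i x)"
  using assms(2)
  by (induction I rule: infinite_finite_induct) (auto intro: Ck_on_add Ck_on_const assms(1))

text \<open>By the Leibniz rule the derivative is a sum of two terms of the same shape, one factor
  being differentiated and the other only lowered in order. Scalar multiples, products and inner
  products are the instances used.\<close>

lemma Ck_on_bilinear:
  assumes P: "bounded_bilinear P" and S: "open S" and "Ck_on k S F" "Ck_on k S G"
  shows "Ck_on k S (\<lambda>x. P (F x) (G x))"
  using assms(3,4)
proof (induction k arbitrary: F G)
  case 0
  then show ?case using bounded_bilinear.continuous_on[OF P] by simp
next
  case (Suc k)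
  then have *: "Ck_on k S F" "Ck_on k S G"
    by (blast dest: Ck_on_SucD)+
  show ?case
  proof (rule Ck_on_SucI[OF S, where F' = "\<lambda>x v. P (F x) (frechet_derivative G (at x) v)
        + P (frechet_derivative F (at x) v) (G x)"])
    show "Ck_on k S (\<lambda>x. P (F x) (frechet_derivative G (at x) v)
        + P (frechet_derivative F (at x) v) (G x))" for v
      using Suc.prems * by (intro Ck_on_add S Suc.IH) simp_all
  qed (use Suc.prems in \<open>auto intro!: bounded_bilinear.FDERIV[OF P] simp: frechet_derivative_works\<close>)
qed

text \<open>\<open>Ck_on\<close> controls derivatives only in a fixed direction. Expanding a
  direction that varies with the point leaves fixed basis directions with varying scalar
  coefficients.\<close>

lemma frechet_derivative_sum_Basis:
  assumes "G differentiable at (y::'b::euclidean_space)"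
  shows "frechet_derivative G (at y) v
    = (\<Sum>b\<in>Basis. (v \<bullet> b) *\<^sub>R frechet_derivative G (at y) b)"
proof -
  interpret linear "frechet_derivative G (at y)"
    using assms by (rule linear_frechet_derivative)
  have "frechet_derivative G (at y) v = frechet_derivative G (at y) (\<Sum>b\<in>Basis. (v \<bullet> b) *\<^sub>R b)"
    by (simp add: euclidean_representation)
  then show ?thesis by (simp add: sum scale)
qed

lemma Ck_on_compose:
  fixes F :: "'a::euclidean_space \<Rightarrow> 'b::euclidean_space"
  assumes S: "open S" and T: "open T" and "F ` S \<subseteq> T" "Ck_on k S F" "Ck_on k T G"
  shows "Ck_on k S (\<lambda>x. G (F x))"
  using assms(3-5)
proof (induction k arbitrary: F G)
  case 0
  then show ?case using continuous_on_compose2[of T G S F] by auto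
next
  case (Suc k)
  show ?case
  \<comment> \<open>The outer derivative is taken in the moving direction \<open>DF(x) v\<close>.
    Expanded in the basis, it becomes a sum of products whose factors have order \<open>k\<close>,
    by the induction hypothesis for the partial derivatives of \<open>G\<close>.\<close>
  proof (rule Ck_on_SucI[OF S, where F' = "\<lambda>x v. \<Sum>b\<in>Basis.
        (frechet_derivative F (at x) v \<bullet> b) *\<^sub>R frechet_derivative G (at (F x)) b"])
    fix x assume x: "x \<in> S"
    have "((\<lambda>x. G (F x)) has_derivative
        (\<lambda>v. frechet_derivative G (at (F x)) (frechet_derivative F (at x) v))) (at x)"
      using Suc.prems x
      by (intro diff_chain_at[of F _ x G, unfolded o_def])
        (auto simp: frechet_derivative_works[symmetric])
    moreover have "frechet_derivative G (at (F x)) (frechet_derivative F (at x) v) = (\<Sum>b\<in>Basis.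
        (frechet_derivative F (at x) v \<bullet> b) *\<^sub>R frechet_derivative G (at (F x)) b)" for v
      using Suc.prems x by (intro frechet_derivative_sum_Basis) auto
    ultimately show "((\<lambda>x. G (F x)) has_derivative (\<lambda>v. \<Sum>b\<in>Basis.
        (frechet_derivative F (at x) v \<bullet> b) *\<^sub>R frechet_derivative G (at (F x)) b)) (at x)"
      by (rule has_derivative_eq_rhs[OF _ ext])
  next
    fix v
    have "Ck_on k S (\<lambda>x. frechet_derivative F (at x) v)"
      "\<And>b. Ck_on k T (\<lambda>x. frechet_derivative G (at x) b)" "Ck_on k S F"
      using Suc.prems Ck_on_SucD[OF Suc.prems(2)] by simp_all
    then have "Ck_on k S (\<lambda>x. frechet_derivative F (at x) v \<bullet> b)"
      "Ck_on k S (\<lambda>x. frechet_derivative G (at (F x)) b)" for b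
      using Suc.prems(1) Suc.IH[of F "\<lambda>y. frechet_derivative G (at y) b"]
      by (auto intro!: Ck_on_bilinear[OF bounded_bilinear_inner] Ck_on_const S)
    then show "Ck_on k S (\<lambda>x. \<Sum>b\<in>Basis.
        (frechet_derivative F (at x) v \<bullet> b) *\<^sub>R frechet_derivative G (at (F x)) b)"
      by (intro Ck_on_sum S Ck_on_bilinear[OF bounded_bilinear_scaleR])
  qed
qed

section \<open>Closure properties of smooth functions, order by order\<close>

lemma smooth_on_subset: "smooth_on S F \<Longrightarrow> T \<subseteq> S \<Longrightarrow> smooth_on T F"
  unfolding smooth_on_def using Ck_on_subset by blast

lemma smooth_on_cong:
  "open S \<Longrightarrow> smooth_on S F \<Longrightarrow> (\<And>x. x \<in> S \<Longrightarrow> F x = G x) \<Longrightarrow> smooth_on S G"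
  unfolding smooth_on_def using Ck_on_cong by blast

lemma smooth_on_local:
  "(\<And>x. x \<in> S \<Longrightarrow> \<exists>T. open T \<and> x \<in> T \<and> smooth_on T F) \<Longrightarrow> smooth_on S F"
  unfolding smooth_on_def by (metis Ck_on_local)

lemma smooth_on_const: "open S \<Longrightarrow> smooth_on S (\<lambda>x. c)"
  by (simp add: smooth_on_def Ck_on_const)

lemma smooth_on_linear: "bounded_linear L \<Longrightarrow> open S \<Longrightarrow> smooth_on S L"
  by (simp add: smooth_on_def Ck_on_linear)

lemma smooth_on_add:
  "open S \<Longrightarrow> smooth_on S F \<Longrightarrow> smooth_on S G \<Longrightarrow> smooth_on S (\<lambda>x. F x + G x)"
  by (simp add: smooth_on_def Ck_on_add)

lemma smooth_on_sum:
  "open S \<Longrightarrow> (\<And>i. i \<in> I \<Longrightarrow> smooth_on S (F i)) \<Longrightarrow> smooth_on S (\<lambda>x. \<Sum>i\<in>I. F i x)"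
  by (simp add: smooth_on_def Ck_on_sum)

lemma smooth_on_bilinear:
  "bounded_bilinear P \<Longrightarrow> open S \<Longrightarrow> smooth_on S F \<Longrightarrow> smooth_on S G \<Longrightarrow>
    smooth_on S (\<lambda>x. P (F x) (G x))"
  by (simp add: smooth_on_def Ck_on_bilinear)

lemmas smooth_on_scaleR = smooth_on_bilinear[OF bounded_bilinear_scaleR]
  and smooth_on_mult = smooth_on_bilinear[OF bounded_bilinear_mult]
  and smooth_on_inner = smooth_on_bilinear[OF bounded_bilinear_inner]

lemma smooth_on_compose:
  fixes F :: "'a::euclidean_space \<Rightarrow> 'b::euclidean_space"
  shows "open S \<Longrightarrow> open T \<Longrightarrow> F ` S \<subseteq> T \<Longrightarrow> smooth_on S F \<Longrightarrow> smooth_on T G \<Longrightarrow>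
    smooth_on S (\<lambda>x. G (F x))"
  unfolding smooth_on_def using Ck_on_compose by blast

lemma smooth_on_imp_differentiable: "smooth_on S F \<Longrightarrow> x \<in> S \<Longrightarrow> F differentiable at x"
  unfolding smooth_on_def by (metis Ck_on.simps(2))

lemma smooth_on_frechet_derivative:
  "smooth_on S F \<Longrightarrow> smooth_on S (\<lambda>x. frechet_derivative F (at x) v)"
  unfolding smooth_on_def by (metis Ck_on.simps(2))

lemma smooth_on_frechet_derivative_apply:
  fixes F :: "'a::euclidean_space \<Rightarrow> 'b::real_normed_vector"
  assumes "open S" "smooth_on S F" "smooth_on S Y"
  shows "smooth_on S (\<lambda>x. frechet_derivative F (at x) (Y x))"
proof (rule smooth_on_cong[OF assms(1)])
  show "smooth_on S (\<lambda>x. \<Sum>b\<in>Basis. (Y x \<bullet> b) *\<^sub>R frechet_derivative F (at x) b)"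
    by (intro smooth_on_sum smooth_on_scaleR smooth_on_inner smooth_on_const
        smooth_on_frechet_derivative assms)
qed (metis frechet_derivative_sum_Basis smooth_on_imp_differentiable assms(2))

lemma smooth_on_inverse:
  fixes F :: "'a::euclidean_space \<Rightarrow> real"
  assumes "open S" "smooth_on S F" "\<And>x. x \<in> S \<Longrightarrow> F x \<noteq> 0"
  shows "smooth_on S (\<lambda>x. inverse (F x))"
proof -
  have "Ck_on k (- {0}) (inverse :: real \<Rightarrow> real)" for k
  proof (induction k)
    case 0
    then show ?case by (auto intro!: continuous_intros)
  next
    case (Suc k)
    show ?case
    \<comment> \<open>The derivative is again built from \<open>inverse\<close> by products, so the
      induction closes. It is written with a factor \<open>- 1\<close> to be a product of known
      functions.\<close>
    proof (rule Ck_on_SucI[where F' = "\<lambda>x v. (- 1) * ((inverse x * v) * inverse x)"])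
      show "Ck_on k (- {0}) (\<lambda>x. (- 1) * ((inverse x * v) * inverse x))" for v :: real
        by (intro Ck_on_bilinear[OF bounded_bilinear_mult] Ck_on_const Suc) auto
    qed (auto intro!: has_derivative_eq_rhs[OF has_derivative_inverse'])
  qed
  then have "smooth_on (- {0}) (inverse :: real \<Rightarrow> real)"
    by (simp add: smooth_on_def)
  then show ?thesis
    using assms by (intro smooth_on_compose[of S "- {0}" F inverse]) auto
qed


subsection \<open>Bump functions\<close>

text \<open>The derivatives of \<open>exp (- 1 / x)\<close> are polynomials in \<open>1 / x\<close>
  times the same exponential. Carrying the polynomial along gives a family closed under
  differentiation.\<close>

definition flat_fun :: "real poly \<Rightarrow> real \<Rightarrow> real" where
  "flat_fun p x = (if x > 0 then poly p (1 / x) * exp (- 1 / x) else 0)"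

lemma tendsto_poly_exp_minus: "((\<lambda>y::real. poly p y * exp (- y)) \<longlongrightarrow> 0) at_top"
proof -
  have "((\<lambda>y::real. coeff p i * y ^ i * exp (- y)) \<longlongrightarrow> 0) at_top" for i
    using tendsto_mult_right_zero[OF tendsto_power_div_exp_0[of i], of "coeff p i"]
    by (simp add: exp_minus divide_inverse mult.assoc)
  then have "((\<lambda>y::real. \<Sum>i\<le>degree p. coeff p i * y ^ i * exp (- y)) \<longlongrightarrow> 0) at_top"
    by (rule tendsto_null_sum)
  then show ?thesis
    by (simp add: poly_altdef sum_distrib_right)
qed

text \<open>In the variable y = 1 / x one has dy/dx = - y^2, and p(y) exp(-y) has y-derivative
  (p'(y) - p(y)) exp(-y). The factor \<open>[:0, 0, 1:]\<close> is y^2.\<close>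

lemma flat_fun_has_derivative:
  "(flat_fun p has_real_derivative flat_fun ([:0, 0, 1:] * (p - pderiv p)) x) (at x)"
proof -
  consider "x > 0" | "x < 0" | "x = 0" by linarith
  then show ?thesis
  proof cases
    case 1
    have "((\<lambda>x. poly p (1 / x) * exp (- 1 / x)) has_real_derivative
        flat_fun ([:0, 0, 1:] * (p - pderiv p)) x) (at x)"
      using 1
      by (auto intro!: derivative_eq_intros DERIV_chain2[OF poly_DERIV]
          simp: flat_fun_def field_simps power2_eq_square)
    moreover have "\<forall>\<^sub>F y in nhds x. flat_fun p y = poly p (1 / y) * exp (- 1 / y)"
      using eventually_nhds_in_open[of "{0<..}" x] 1
      by (auto elim!: eventually_mono simp: flat_fun_def)
    ultimately show ?thesis
      by (subst DERIV_cong_ev[OF refl _ refl]) auto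
  next
    case 2
    have "\<forall>\<^sub>F y in nhds x. flat_fun p y = 0"
      using eventually_nhds_in_open[of "{..<0}" x] 2
      by (auto elim!: eventually_mono simp: flat_fun_def)
    moreover have "flat_fun ([:0, 0, 1:] * (p - pderiv p)) x = 0"
      using 2 by (simp add: flat_fun_def)
    ultimately show ?thesis
      using DERIV_const by (subst DERIV_cong_ev[OF refl _ refl]) auto
  next
    case 3
    \<comment> \<open>The difference quotient at 0 is of the same type: dividing by the argument
      multiplies the polynomial by its variable, whence \<open>[:0, 1:] * p\<close>, and exponential
      decay wins.\<close>
    have "((\<lambda>y. flat_fun p y / y) \<longlongrightarrow> 0) (at_right 0)"
    proof -
      have "((\<lambda>y::real. poly ([:0, 1:] * p) (inverse y) * exp (- inverse y)) \<longlongrightarrow> 0) (at_right 0)"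
        using filterlim_compose[OF tendsto_poly_exp_minus filterlim_inverse_at_top_right] .
      moreover have "\<forall>\<^sub>F y in at_right 0.
          poly ([:0, 1:] * p) (inverse y) * exp (- inverse y) = flat_fun p y / y"
        using eventually_at_right_less[of 0]
        by (auto elim!: eventually_mono simp: flat_fun_def field_simps)
      ultimately show ?thesis
        by (rule Lim_transform_eventually)
    qed
    moreover have "((\<lambda>y. flat_fun p y / y) \<longlongrightarrow> 0) (at_left 0)"
    proof -
      have "\<forall>\<^sub>F y in at_left (0::real). 0 = flat_fun p y / y"
        by (auto simp: eventually_at_filter flat_fun_def)
      then show ?thesis
        by (rule Lim_transform_eventually[OF tendsto_const])
    qed
    ultimately have "((\<lambda>y. flat_fun p y / y) \<longlongrightarrow> 0) (at 0)"
      using filterlim_split_at by blast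
    then show ?thesis
      using 3 by (simp add: has_field_derivative_iff flat_fun_def)
  qed
qed

lemma smooth_on_flat_fun: "smooth_on UNIV (flat_fun p)"
proof -
  have "Ck_on k UNIV (flat_fun p)" for k
  proof (induction k arbitrary: p)
    case 0
    then show ?case
      using DERIV_isCont[OF flat_fun_has_derivative] by (simp add: continuous_at_imp_continuous_on)
  next
    case (Suc k)
    show ?case
      by (rule Ck_on_SucI[where F' = "\<lambda>x v. flat_fun ([:0, 0, 1:] * (p - pderiv p)) x * v"])
        (use Suc flat_fun_has_derivative in \<open>auto intro!: Ck_on_const
          Ck_on_bilinear[OF bounded_bilinear_mult] simp: has_field_derivative_def
          simp del: mult_pCons_left\<close>)
  qed
  then show ?thesis by (simp add: smooth_on_def)
qed

lemma euclidean_bump: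
  fixes a :: "'a::euclidean_space"
  assumes "r > 0"
  obtains h :: "'a \<Rightarrow> real"
  where "smooth_on UNIV h" "h a = 1" "\<And>x. x \<notin> cball a r \<Longrightarrow> h x = 0"
proof
  \<comment> \<open>The argument is r^2 - |x - a|^2, negative outside the ball. At \<open>a\<close>
    the flat function takes the value exp(-1/r^2), which the last factor normalises to 1.\<close>
  define h where "h x = flat_fun 1 (r\<^sup>2 + (- 1) * ((x + - a) \<bullet> (x + - a))) * exp (1 / r\<^sup>2)" for x
  show "smooth_on UNIV h"
    unfolding h_def
    by (intro smooth_on_mult smooth_on_const smooth_on_compose[OF _ _ _ _ smooth_on_flat_fun]
        smooth_on_add smooth_on_inner smooth_on_linear bounded_linear_ident) auto
  show "h a = 1"
    using assms by (simp add: h_def flat_fun_def flip: exp_add)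
  fix x assume "x \<notin> cball a r"
  then have "r\<^sup>2 < (norm (x - a))\<^sup>2"
    using assms by (intro power_strict_mono) (auto simp: dist_norm norm_minus_commute)
  then show "h x = 0"
    by (simp add: h_def flat_fun_def power2_norm_eq_inner)
qed

section \<open>Charts, coordinates and tangent spaces\<close>

lemma coord_simps [simp]:
  "coord 0 c = 0" "coord (v + w) c = coord v c + coord w c" "coord (v - w) c = coord v c - coord w c"
  "coord (- v) c = - coord v c" "coord (r *\<^sub>R v) c = r *\<^sub>R coord v c"
  by (simp_all add: zero_tvec_def plus_tvec_def minus_tvec_def uminus_tvec_def scaleR_tvec_def
      Tvec_inverse)

lemma coord_sum [simp]: "coord (\<Sum>i\<in>I. v i) c = (\<Sum>i\<in>I. coord (v i) c)"
  by (induction I rule: infinite_finite_induct) auto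

lemma coord_Tvec [simp]: "coord (Tvec F) c = F c"
  by (simp add: Tvec_inverse)

lemma tvec_eqI: "(\<And>c. coord v c = coord w c) \<Longrightarrow> v = w"
  by (metis coord_inject ext)

text \<open>A coordinate expression factors through another chart only on the overlap of the
  domains, so the factorisation of \<open>H\<close> is required on an open set alone.\<close>

lemma frechet_derivative_chain_open:
  assumes "open S" "x \<in> S" "\<And>y. y \<in> S \<Longrightarrow> H y = G (F y)"
    and F: "F differentiable at x" and G: "G differentiable at (F x)"
  shows "frechet_derivative H (at x) v
    = frechet_derivative G (at (F x)) (frechet_derivative F (at x) v)"
proof -
  have "((\<lambda>y. G (F y)) has_derivative
      (\<lambda>v. frechet_derivative G (at (F x)) (frechet_derivative F (at x) v))) (at x)"
    by (rule diff_chain_at[unfolded o_def]) (use F G in \<open>simp_all add: frechet_derivative_works\<close>)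
  then have "(H has_derivative
      (\<lambda>v. frechet_derivative G (at (F x)) (frechet_derivative F (at x) v))) (at x)"
    by (rule has_derivative_transform_within_open[OF _ assms(1,2)]) (simp add: assms(3))
  from fun_cong[OF frechet_derivative_at[OF this], symmetric] show ?thesis .
qed

lemma tangent_spaceD:
  assumes "v \<in> tangent_space A p"
  shows "c \<in> charts_at A p \<Longrightarrow> d \<in> charts_at A p \<Longrightarrow>
      coord v d = frechet_derivative (snd d \<circ> chart_inv c) (at (snd c p)) (coord v c)"
    and "c \<notin> charts_at A p \<Longrightarrow> coord v c = 0"
  using assms unfolding tangent_space_def by blast+

lemma tangent_spaceI:
  assumes "\<And>c d. c \<in> charts_at A p \<Longrightarrow> d \<in> charts_at A p \<Longrightarrow>
      coord v d = frechet_derivative (snd d \<circ> chart_inv c) (at (snd c p)) (coord v c)"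
    and "\<And>c. c \<notin> charts_at A p \<Longrightarrow> coord v c = 0"
  shows "v \<in> tangent_space A p"
  using assms unfolding tangent_space_def by blast

lemma charts_atD: "c \<in> charts_at A p \<Longrightarrow> c \<in> A" "c \<in> charts_at A p \<Longrightarrow> p \<in> fst c"
  by (auto simp: charts_at_def)

section \<open>Chart domains and the algebra of smooth functions\<close>

context
  fixes A :: "('m::{t2_space, second_countable_topology}, 'a::euclidean_space) chart set"
  assumes A: "smooth_atlas A"
begin

lemma ex_chart: obtains c where "c \<in> charts_at A p"
  using A unfolding smooth_atlas_def charts_at_def by blast

lemma SOME_chart: "(SOME c. c \<in> charts_at A p) \<in> charts_at A p"
  by (metis ex_chart someI_ex)

lemma chart_homeomorphism:
  "c \<in> A \<Longrightarrow> homeomorphism (fst c) (snd c ` fst c) (snd c) (chart_inv c)"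
  using A by (simp add: smooth_atlas_def)

lemma open_chart_domain: "c \<in> A \<Longrightarrow> open (fst c)"
  using A by (simp add: smooth_atlas_def)

lemma chart_inv_coord: "c \<in> A \<Longrightarrow> p \<in> fst c \<Longrightarrow> chart_inv c (snd c p) = p"
  using homeomorphism_apply1[OF chart_homeomorphism] .

lemma open_chart_image:
  assumes "c \<in> A" "open U" shows "open (snd c ` (U \<inter> fst c))"
proof -
  have "openin (top_of_set (snd c ` fst c)) (snd c ` (U \<inter> fst c))"
    using homeomorphism_imp_open_map[OF chart_homeomorphism[OF assms(1)]]
    by (metis assms(2) inf_commute openin_open_Int)
  moreover have "open (snd c ` fst c)"
    using A assms by (simp add: smooth_atlas_def)
  ultimately show ?thesis using openin_open_trans by blast
qed

text \<open>The coordinate expressions of the identity are the transition maps, so facts about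
  smooth maps specialise to changes of coordinates, and vector fields are sections along
  \<open>id\<close>.\<close>

lemma smooth_map_id: "smooth_map A A id"
  using A by (auto simp: smooth_map_def smooth_atlas_def)

lemma smooth_fun_subset: "smooth_fun A U h \<Longrightarrow> V \<subseteq> U \<Longrightarrow> smooth_fun A V h"
  unfolding smooth_fun_def by (meson Int_mono image_mono order_refl smooth_on_subset)

lemma smooth_fun_cong:
  assumes "open U" "smooth_fun A U h" "\<And>q. q \<in> U \<Longrightarrow> h q = k q"
  shows "smooth_fun A U k"
  unfolding smooth_fun_def
proof
  fix c assume c: "c \<in> A"
  show "smooth_on (snd c ` (U \<inter> fst c)) (k \<circ> chart_inv c)"
    by (rule smooth_on_cong[OF open_chart_image[OF c assms(1)], of "h \<circ> chart_inv c"])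
      (use assms c in \<open>auto simp: smooth_fun_def chart_inv_coord\<close>)
qed

lemma smooth_fun_local:
  assumes "\<And>p. p \<in> U \<Longrightarrow> \<exists>V. open V \<and> p \<in> V \<and> smooth_fun A V h"
  shows "smooth_fun A U h"
  unfolding smooth_fun_def
proof
  fix c assume c: "c \<in> A"
  show "smooth_on (snd c ` (U \<inter> fst c)) (h \<circ> chart_inv c)"
  proof (rule smooth_on_local)
    fix x assume "x \<in> snd c ` (U \<inter> fst c)"
    then obtain p where p: "p \<in> U" "p \<in> fst c" "x = snd c p" by auto
    then obtain V where "open V" "p \<in> V" "smooth_fun A V h" using assms by blast
    then show "\<exists>T. open T \<and> x \<in> T \<and> smooth_on T (h \<circ> chart_inv c)"
      using c p open_chart_image[of c V] by (auto simp: smooth_fun_def)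
  qed
qed

lemma smooth_fun_const: "open U \<Longrightarrow> smooth_fun A U (\<lambda>_. r)"
  by (simp add: smooth_fun_def o_def smooth_on_const open_chart_image)

lemma smooth_fun_add:
  "open U \<Longrightarrow> smooth_fun A U h \<Longrightarrow> smooth_fun A U k \<Longrightarrow> smooth_fun A U (\<lambda>q. h q + k q)"
  by (simp add: smooth_fun_def o_def smooth_on_add open_chart_image)

lemma smooth_fun_mult:
  "open U \<Longrightarrow> smooth_fun A U h \<Longrightarrow> smooth_fun A U k \<Longrightarrow> smooth_fun A U (\<lambda>q. h q * k q)"
  by (simp add: smooth_fun_def o_def smooth_on_mult open_chart_image)

lemma smooth_fun_sum:
  "open U \<Longrightarrow> (\<And>i. i \<in> I \<Longrightarrow> smooth_fun A U (h i)) \<Longrightarrow> smooth_fun A U (\<lambda>q. \<Sum>i\<in>I. h i q)"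
  by (simp add: smooth_fun_def o_def smooth_on_sum open_chart_image)

lemma smooth_fun_divide:
  assumes "open U" "smooth_fun A U h" "smooth_fun A U k" "\<And>q. q \<in> U \<Longrightarrow> k q \<noteq> 0"
  shows "smooth_fun A U (\<lambda>q. h q / k q)"
proof -
  have "smooth_fun A U (\<lambda>q. inverse (k q))"
    unfolding smooth_fun_def o_def
  proof
    fix c assume c: "c \<in> A"
    show "smooth_on (snd c ` (U \<inter> fst c)) (\<lambda>x. inverse (k (chart_inv c x)))"
      by (rule smooth_on_inverse[OF open_chart_image[OF c assms(1)]])
        (use assms c in \<open>auto simp: smooth_fun_def o_def chart_inv_coord\<close>)
  qed
  then show ?thesis
    using smooth_fun_mult[OF assms(1,2)] by (simp add: divide_inverse)
qed

end

section \<open>Smooth maps in coordinates\<close>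

context
  fixes A :: "('m::{t2_space, second_countable_topology}, 'a::euclidean_space) chart set"
    and B :: "('n::{t2_space, second_countable_topology}, 'b::euclidean_space) chart set"
    and f :: "'m \<Rightarrow> 'n"
  assumes A: "smooth_atlas A" and B: "smooth_atlas B" and f: "smooth_map A B f"
begin

lemma open_vimage_smooth_map: "open V \<Longrightarrow> open (f -` V)"
  using f continuous_open_vimage[of V f] by (auto simp: smooth_map_def continuous_on_eq_continuous_at)

lemma smooth_on_map:
  "c \<in> A \<Longrightarrow> d \<in> B \<Longrightarrow> smooth_on (snd c ` (fst c \<inter> f -` fst d)) (snd d \<circ> f \<circ> chart_inv c)"
  using f by (simp add: smooth_map_def)

lemma map_differentiable:
  assumes "c \<in> charts_at A p" "d \<in> charts_at B (f p)"
  shows "(snd d \<circ> f \<circ> chart_inv c) differentiable at (snd c p)"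
  using smooth_on_map[of c d] assms
  by (intro smooth_on_imp_differentiable) (auto simp: charts_at_def)

lemma open_chart_map:
  assumes "c \<in> A" "d \<in> B" "open U" shows "open (snd c ` (U \<inter> fst c \<inter> f -` fst d))"
proof -
  have "U \<inter> fst c \<inter> f -` fst d = (U \<inter> f -` fst d) \<inter> fst c" by auto
  then show ?thesis
    using open_chart_image[OF A assms(1), of "U \<inter> f -` fst d"] open_vimage_smooth_map
      open_chart_domain[OF B assms(2)] assms(3) by (simp add: open_Int)
qed

end

section \<open>The differential and its independence of charts\<close>

context
  fixes A :: "('m::{t2_space, second_countable_topology}, 'a::euclidean_space) chart set"
    and B :: "('n::{t2_space, second_countable_topology}, 'b::euclidean_space) chart set"
    and f :: "'m \<Rightarrow> 'n"
  assumes A: "smooth_atlas A" and B: "smooth_atlas B" and f: "smooth_map A B f"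
begin

text \<open>This transformation law is what makes the coordinate family of an image vector
  tangent.\<close>

lemma map_change_target:
  assumes "c \<in> charts_at A p" "d \<in> charts_at B (f p)" "d' \<in> charts_at B (f p)"
  shows "frechet_derivative (snd d' \<circ> f \<circ> chart_inv c) (at (snd c p)) y
    = frechet_derivative (snd d' \<circ> chart_inv d) (at (snd d (f p)))
        (frechet_derivative (snd d \<circ> f \<circ> chart_inv c) (at (snd c p)) y)"
proof -
  have eq: "(snd d \<circ> f \<circ> chart_inv c) (snd c p) = snd d (f p)"
    using assms by (auto simp: chart_inv_coord[OF A] charts_at_def)
  show ?thesis
    unfolding eq[symmetric]
  proof (rule frechet_derivative_chain_open)
    show "open (snd c ` (f -` fst d' \<inter> fst c \<inter> f -` fst d))"
      using assms open_chart_map[OF A B f] open_vimage_smooth_map[OF A B f] open_chart_domain[OF B]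
      by (simp add: charts_at_def)
    show "(snd d' \<circ> chart_inv d) differentiable at ((snd d \<circ> f \<circ> chart_inv c) (snd c p))"
      using map_differentiable[OF B B smooth_map_id[OF B], of d "f p" d'] assms eq by simp
    show "(snd d \<circ> f \<circ> chart_inv c) differentiable at (snd c p)"
      by (rule map_differentiable[OF A B f assms(1,2)])
  qed (use assms in \<open>auto simp: charts_at_def chart_inv_coord[OF A] chart_inv_coord[OF B]\<close>)
qed

text \<open>It makes the chart selected by \<open>SOME\<close> in \<open>differential\<close>
  irrelevant.\<close>

lemma map_change_source:
  assumes "c \<in> charts_at A p" "c' \<in> charts_at A p" "d \<in> charts_at B (f p)"
  shows "frechet_derivative (snd d \<circ> f \<circ> chart_inv c) (at (snd c p)) y
    = frechet_derivative (snd d \<circ> f \<circ> chart_inv c') (at (snd c' p))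
        (frechet_derivative (snd c' \<circ> chart_inv c) (at (snd c p)) y)"
proof -
  have eq: "(snd c' \<circ> chart_inv c) (snd c p) = snd c' p"
    using assms by (auto simp: chart_inv_coord[OF A] charts_at_def)
  show ?thesis
    unfolding eq[symmetric]
  proof (rule frechet_derivative_chain_open)
    show "open (snd c ` (fst c' \<inter> fst c \<inter> f -` fst d))"
      using assms open_chart_map[OF A B f] open_chart_domain[OF A] by (simp add: charts_at_def)
    show "(snd c' \<circ> chart_inv c) differentiable at (snd c p)"
      using map_differentiable[OF A A smooth_map_id[OF A], of c p c'] assms by simp
    show "(snd d \<circ> f \<circ> chart_inv c') differentiable at ((snd c' \<circ> chart_inv c) (snd c p))"
      using map_differentiable[OF A B f, of c' p d] assms eq by simp
  qed (use assms in \<open>auto simp: charts_at_def chart_inv_coord[OF A]\<close>)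
qed

text \<open>Only the coordinate in one selected chart enters, so linearity holds on all coordinate
  families and later uses carry no tangency conditions.\<close>

lemma linear_differential: "linear (differential A B f p)"
proof -
  define c where "c = (SOME c. c \<in> charts_at A p)"
  have c: "c \<in> charts_at A p" unfolding c_def by (rule SOME_chart[OF A])
  have lin: "linear (frechet_derivative (snd d \<circ> f \<circ> chart_inv c) (at (snd c p)))"
    if "d \<in> charts_at B (f p)" for d
    using map_differentiable[OF A B f c that] by (rule linear_frechet_derivative)
  show ?thesis
    by (rule linearI; rule tvec_eqI)
      (simp_all add: differential_def Let_def linear_add[OF lin] linear_scale[OF lin] flip: c_def)
qed

lemma coord_differential:
  assumes "u \<in> tangent_space A p" "c \<in> charts_at A p" "d \<in> charts_at B (f p)"
  shows "coord (differential A B f p u) d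
    = frechet_derivative (snd d \<circ> f \<circ> chart_inv c) (at (snd c p)) (coord u c)"
proof -
  define c0 where "c0 = (SOME c. c \<in> charts_at A p)"
  have c0: "c0 \<in> charts_at A p" unfolding c0_def by (rule SOME_chart[OF A])
  have "coord u c0 = frechet_derivative (snd c0 \<circ> chart_inv c) (at (snd c p)) (coord u c)"
    by (rule tangent_spaceD(1)) (use assms c0 in auto)
  then show ?thesis
    using assms map_change_source[OF assms(2) c0 assms(3)]
    by (simp add: differential_def Let_def flip: c0_def)
qed

lemma differential_in_tangent_space:
  assumes "u \<in> tangent_space A p"
  shows "differential A B f p u \<in> tangent_space B (f p)"
proof -
  obtain c where c: "c \<in> charts_at A p" by (rule ex_chart[OF A])
  show ?thesis
  proof (rule tangent_spaceI)
    fix d d' assume "d \<in> charts_at B (f p)" "d' \<in> charts_at B (f p)"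
    then show "coord (differential A B f p u) d'
        = frechet_derivative (snd d' \<circ> chart_inv d) (at (snd d (f p))) (coord (differential A B f p u) d)"
      using map_change_target[OF c, of d d' "coord u c"] assms c
      by (simp add: coord_differential[where c = c])
  qed (simp add: differential_def Let_def)
qed

end

text \<open>The vector field on the domain of a chart \<open>d\<close> with constant coordinate vector \<open>y\<close>.\<close>

definition coord_vec ::
  "('m, 'a::real_normed_vector) chart set \<Rightarrow> ('m, 'a) chart \<Rightarrow> 'a \<Rightarrow> 'm \<Rightarrow> ('m, 'a) tvec" where
  "coord_vec A d y q = Tvec (\<lambda>d'. if d' \<in> charts_at A q
     then frechet_derivative (snd d' \<circ> chart_inv d) (at (snd d q)) y else 0)"

section \<open>Tangent spaces and coordinate fields\<close>

context
  fixes A :: "('m::{t2_space, second_countable_topology}, 'a::euclidean_space) chart set"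
  assumes A: "smooth_atlas A"
begin

lemmas transition_differentiable = map_differentiable[OF A A smooth_map_id[OF A], simplified]
  and transition_cocycle = map_change_target[OF A A smooth_map_id[OF A], simplified]

lemma frechet_derivative_transition_same:
  assumes "d \<in> charts_at A q"
  shows "frechet_derivative (snd d \<circ> chart_inv d) (at (snd d q)) y = y"
proof -
  have "((\<lambda>x. x) has_derivative (\<lambda>x. x)) (at (snd d q))"
    by (rule has_derivative_ident)
  then have "((snd d \<circ> chart_inv d) has_derivative (\<lambda>x. x)) (at (snd d q))"
    by (rule has_derivative_transform_within_open[OF _ open_chart_image[OF A, of d UNIV]])
      (use assms in \<open>auto simp: charts_at_def chart_inv_coord[OF A]\<close>)
  from fun_cong[OF frechet_derivative_at[OF this], symmetric] show ?thesis .
qed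

lemma subspace_tangent_space: "subspace (tangent_space A p)"
proof -
  have lin: "linear (frechet_derivative (snd d \<circ> chart_inv c) (at (snd c p)))"
    if "c \<in> charts_at A p" "d \<in> charts_at A p" for c d
    using transition_differentiable[OF that] by (rule linear_frechet_derivative)
  show ?thesis
  proof (rule subspaceI)
    show "0 \<in> tangent_space A p"
      by (rule tangent_spaceI) (simp_all add: linear_0[OF lin])
  next
    fix u v assume *: "u \<in> tangent_space A p" "v \<in> tangent_space A p"
    show "u + v \<in> tangent_space A p"
      by (rule tangent_spaceI)
        (auto simp: linear_add[OF lin] tangent_spaceD(2)[OF *(1)] tangent_spaceD(2)[OF *(2)]
          intro!: arg_cong2[where f = "(+)"] tangent_spaceD(1)[OF *(1)] tangent_spaceD(1)[OF *(2)])
  next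
    fix r u assume *: "u \<in> tangent_space A p"
    show "r *\<^sub>R u \<in> tangent_space A p"
      by (rule tangent_spaceI)
        (auto simp: linear_scale[OF lin] tangent_spaceD(2)[OF *] intro!: tangent_spaceD(1)[OF *])
  qed
qed

lemma coord_coord_vec: "d \<in> charts_at A q \<Longrightarrow> coord (coord_vec A d y q) d = y"
  by (simp add: coord_vec_def frechet_derivative_transition_same)

lemma coord_vec_in_tangent_space:
  "d \<in> charts_at A q \<Longrightarrow> coord_vec A d y q \<in> tangent_space A q"
  by (rule tangent_spaceI) (auto simp: coord_vec_def intro: transition_cocycle)

lemma tangent_eqI:
  assumes "u \<in> tangent_space A p" "v \<in> tangent_space A p" "d \<in> charts_at A p"
    "coord u d = coord v d"
  shows "u = v"
proof (rule tvec_eqI)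
  fix c
  show "coord u c = coord v c"
    using tangent_spaceD(1)[OF assms(1), of d c] tangent_spaceD(1)[OF assms(2), of d c]
      tangent_spaceD(2)[OF assms(1), of c] tangent_spaceD(2)[OF assms(2), of c] assms(3,4)
    by (cases "c \<in> charts_at A p") auto
qed

text \<open>The coordinate fields are a local frame of the tangent bundle; linear and differential
  identities are reduced to them through this expansion.\<close>

lemma coord_vec_expansion:
  assumes "u \<in> tangent_space A q" "d \<in> charts_at A q"
  shows "u = (\<Sum>b\<in>Basis. (coord u d \<bullet> b) *\<^sub>R coord_vec A d b q)"
proof (rule tangent_eqI[OF assms(1) _ assms(2)])
  show "(\<Sum>b\<in>Basis. (coord u d \<bullet> b) *\<^sub>R coord_vec A d b q) \<in> tangent_space A q"
    by (intro subspace_sum subspace_scale subspace_tangent_space coord_vec_in_tangent_space assms)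
qed (simp add: coord_coord_vec assms euclidean_representation)

lemma smooth_field_coord_vec:
  assumes d: "d \<in> A"
  shows "smooth_field A (fst d) (coord_vec A d y)"
  unfolding smooth_section_def
proof (intro conjI ballI)
  fix q assume "q \<in> fst d"
  then show "coord_vec A d y q \<in> tangent_space A (id q)"
    using d coord_vec_in_tangent_space by (simp add: charts_at_def)
next
  fix c e assume c: "c \<in> A" and e: "e \<in> A"
  let ?S = "snd c ` (fst d \<inter> fst c \<inter> id -` fst e)"
  let ?T = "snd d ` (fst d \<inter> fst e)"
  have S: "open ?S"
    using open_chart_map[OF A A smooth_map_id[OF A] c e] open_chart_domain[OF A d] by simp
  have T: "open ?T"
    using open_chart_image[OF A d open_chart_domain[OF A e]] by (simp add: Int_commute)
  have "smooth_on ?T (snd e \<circ> chart_inv d)"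
    using smooth_on_map[OF A A smooth_map_id[OF A] d e] by simp
  moreover have "smooth_on ?S (snd d \<circ> chart_inv c)"
    by (rule smooth_on_subset[OF smooth_on_map[OF A A smooth_map_id[OF A] c d, simplified]]) auto
  \<comment> \<open>Seen from chart \<open>c\<close>, coordinate \<open>e\<close> of the field is
    the derivative of the transition from \<open>d\<close> to \<open>e\<close>, evaluated after the
    transition from \<open>c\<close> to \<open>d\<close>.\<close>
  ultimately have "smooth_on ?S
      (\<lambda>x. frechet_derivative (snd e \<circ> chart_inv d) (at ((snd d \<circ> chart_inv c) x)) y)"
    using c d e
    by (intro smooth_on_compose[OF S T _ _ smooth_on_frechet_derivative])
      (auto simp: chart_inv_coord[OF A] o_def)
  then show "smooth_on ?S (\<lambda>x. coord (coord_vec A d y (chart_inv c x)) e)"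
    by (rule smooth_on_cong[OF S])
      (use c d e in \<open>auto simp: coord_vec_def chart_inv_coord[OF A] charts_at_def\<close>)
qed

end

section \<open>Smooth sections along a map\<close>

lemma linear_between_sum:
  assumes "linear_between S T L" "subspace S" "\<And>i. i \<in> I \<Longrightarrow> x i \<in> S"
  shows "L (\<Sum>i\<in>I. r i *\<^sub>R x i) = (\<Sum>i\<in>I. r i *\<^sub>R L (x i))"
proof -
  have L0: "L 0 = 0"
    using assms(1) subspace_0[OF assms(2)] unfolding linear_between_def by (metis scaleR_zero_left)
  show ?thesis
    using assms(3)
  proof (induction I rule: infinite_finite_induct)
    case (insert i I)
    then have "r i *\<^sub>R x i \<in> S" "(\<Sum>i\<in>I. r i *\<^sub>R x i) \<in> S"
      using assms(2) by (auto intro!: subspace_scale subspace_sum)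
    then show ?case
      using insert assms(1) by (simp add: linear_between_def)
  qed (simp_all add: L0)
qed

lemma smooth_sectionD: "smooth_section A B f U W \<Longrightarrow> q \<in> U \<Longrightarrow> W q \<in> tangent_space B (f q)"
  by (simp add: smooth_section_def)

section \<open>Algebra of sections and reduction to coordinate fields\<close>

context
  fixes A :: "('m::{t2_space, second_countable_topology}, 'a::euclidean_space) chart set"
    and B :: "('n::{t2_space, second_countable_topology}, 'b::euclidean_space) chart set"
    and f :: "'m \<Rightarrow> 'n"
  assumes A: "smooth_atlas A" and B: "smooth_atlas B" and f: "smooth_map A B f"
begin

lemma smooth_fun_compose:
  assumes "open V" "smooth_fun B V h"
  shows "smooth_fun A (f -` V) (\<lambda>q. h (f q))"
  unfolding smooth_fun_def
proof
  fix c assume c: "c \<in> A"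
  show "smooth_on (snd c ` (f -` V \<inter> fst c)) ((\<lambda>q. h (f q)) \<circ> chart_inv c)"
  proof (rule smooth_on_local)
    fix x assume "x \<in> snd c ` (f -` V \<inter> fst c)"
    then obtain p where p: "f p \<in> V" "p \<in> fst c" "x = snd c p" by auto
    obtain d where d: "d \<in> B" "f p \<in> fst d"
      using ex_chart[OF B, of "f p"] charts_atD by metis
    let ?S = "snd c ` (f -` V \<inter> fst c \<inter> f -` fst d)"
    have S: "open ?S"
      using open_chart_map[OF A B f c d(1) open_vimage_smooth_map[OF A B f assms(1)]] .
    have "smooth_on ?S (\<lambda>x. (h \<circ> chart_inv d) ((snd d \<circ> f \<circ> chart_inv c) x))"
    proof (rule smooth_on_compose[OF S open_chart_image[OF B d(1) assms(1)]])
      show "smooth_on ?S (snd d \<circ> f \<circ> chart_inv c)"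
        using smooth_on_map[OF A B f c d(1)] by (rule smooth_on_subset) auto
      show "smooth_on (snd d ` (V \<inter> fst d)) (h \<circ> chart_inv d)"
        using assms d by (simp add: smooth_fun_def)
    qed (use c in \<open>auto simp: chart_inv_coord[OF A]\<close>)
    then have "smooth_on ?S ((\<lambda>q. h (f q)) \<circ> chart_inv c)"
      by (rule smooth_on_cong[OF S])
        (use c d in \<open>auto simp: chart_inv_coord[OF A] chart_inv_coord[OF B]\<close>)
    then show "\<exists>T. open T \<and> x \<in> T \<and> smooth_on T ((\<lambda>q. h (f q)) \<circ> chart_inv c)"
      using S p d by blast
  qed
qed

lemma smooth_section_subset:
  assumes "smooth_section A B f U W" "V \<subseteq> U"
  shows "smooth_section A B f V W"
  unfolding smooth_section_def
proof (intro conjI ballI)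
  fix c d assume "c \<in> A" "d \<in> B"
  then have "smooth_on (snd c ` (U \<inter> fst c \<inter> f -` fst d)) (\<lambda>x. coord (W (chart_inv c x)) d)"
    using assms(1) by (simp add: smooth_section_def)
  then show "smooth_on (snd c ` (V \<inter> fst c \<inter> f -` fst d)) (\<lambda>x. coord (W (chart_inv c x)) d)"
    by (rule smooth_on_subset) (use assms(2) in auto)
qed (use assms in \<open>auto simp: smooth_section_def\<close>)

lemma smooth_section_cong:
  assumes "open U" "smooth_section A B f U W" "\<And>q. q \<in> U \<Longrightarrow> W q = Z q"
  shows "smooth_section A B f U Z"
  unfolding smooth_section_def
proof (intro conjI ballI)
  fix c d assume c: "c \<in> A" and d: "d \<in> B"
  show "smooth_on (snd c ` (U \<inter> fst c \<inter> f -` fst d)) (\<lambda>x. coord (Z (chart_inv c x)) d)"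
    by (rule smooth_on_cong[OF open_chart_map[OF A B f c d assms(1)],
          of "\<lambda>x. coord (W (chart_inv c x)) d"])
      (use assms c d in \<open>auto simp: smooth_section_def chart_inv_coord[OF A]\<close>)
qed (use assms in \<open>auto simp: smooth_section_def\<close>)

lemma smooth_section_local:
  assumes "\<And>p. p \<in> U \<Longrightarrow> \<exists>V. open V \<and> p \<in> V \<and> smooth_section A B f V W"
  shows "smooth_section A B f U W"
  unfolding smooth_section_def
proof (intro conjI ballI)
  fix c d assume c: "c \<in> A" and d: "d \<in> B"
  show "smooth_on (snd c ` (U \<inter> fst c \<inter> f -` fst d)) (\<lambda>x. coord (W (chart_inv c x)) d)"
  proof (rule smooth_on_local)
    fix x assume "x \<in> snd c ` (U \<inter> fst c \<inter> f -` fst d)"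
    then obtain p where p: "p \<in> U" "p \<in> fst c" "f p \<in> fst d" "x = snd c p" by auto
    then obtain V where "open V" "p \<in> V" "smooth_section A B f V W" using assms by blast
    then show "\<exists>T. open T \<and> x \<in> T \<and> smooth_on T (\<lambda>x. coord (W (chart_inv c x)) d)"
      using c d p open_chart_map[OF A B f c d, of V]
      by (intro exI[of _ "snd c ` (V \<inter> fst c \<inter> f -` fst d)"]) (auto simp: smooth_section_def)
  qed
qed (use assms in \<open>auto simp: smooth_section_def\<close>)

lemma smooth_section_add:
  assumes "open U" "smooth_section A B f U V" "smooth_section A B f U W"
  shows "smooth_section A B f U (\<lambda>q. V q + W q)"
  using assms
  by (auto simp: smooth_section_def intro!: smooth_on_add open_chart_map[OF A B f]
      subspace_add[OF subspace_tangent_space[OF B]])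

lemma smooth_section_scaleR:
  assumes "open U" "smooth_fun A U h" "smooth_section A B f U W"
  shows "smooth_section A B f U (\<lambda>q. h q *\<^sub>R W q)"
  unfolding smooth_section_def
proof (intro conjI ballI)
  fix c d assume c: "c \<in> A" and d: "d \<in> B"
  have "smooth_on (snd c ` (U \<inter> fst c \<inter> f -` fst d)) (\<lambda>x. h (chart_inv c x))"
    by (rule smooth_on_subset[of "snd c ` (U \<inter> fst c)"])
      (use assms(2) c in \<open>auto simp: smooth_fun_def o_def\<close>)
  then show "smooth_on (snd c ` (U \<inter> fst c \<inter> f -` fst d))
      (\<lambda>x. coord (h (chart_inv c x) *\<^sub>R W (chart_inv c x)) d)"
    using assms c d
    by (auto simp: smooth_section_def intro!: smooth_on_scaleR open_chart_map[OF A B f])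
qed (use assms in \<open>auto simp: smooth_section_def intro!: subspace_scale[OF subspace_tangent_space[OF B]]\<close>)

lemma smooth_section_zero: "open U \<Longrightarrow> smooth_section A B f U (\<lambda>_. 0)"
  by (auto simp: smooth_section_def subspace_0[OF subspace_tangent_space[OF B]]
      intro!: smooth_on_const open_chart_map[OF A B f])

lemma smooth_section_diff:
  assumes "open U" "smooth_section A B f U V" "smooth_section A B f U W"
  shows "smooth_section A B f U (\<lambda>q. V q - W q)"
  using smooth_section_add[OF assms(1,2)
      smooth_section_scaleR[OF assms(1) smooth_fun_const[OF A assms(1), of "- 1"] assms(3)]]
  by simp

lemma smooth_section_sum:
  assumes "open U" "\<And>i. i \<in> I \<Longrightarrow> smooth_section A B f U (W i)"
  shows "smooth_section A B f U (\<lambda>q. \<Sum>i\<in>I. W i q)"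
  using assms(2)
  by (induction I rule: infinite_finite_induct)
    (auto intro: smooth_section_add smooth_section_zero assms(1))

lemma smooth_section_compose:
  assumes "open V" "smooth_field B V Y"
  shows "smooth_section A B f (f -` V) (\<lambda>q. Y (f q))"
  unfolding smooth_section_def
proof (intro conjI ballI)
  fix c d assume c: "c \<in> A" and d: "d \<in> B"
  let ?S = "snd c ` (f -` V \<inter> fst c \<inter> f -` fst d)"
  have S: "open ?S"
    using open_chart_map[OF A B f c d open_vimage_smooth_map[OF A B f assms(1)]] .
  have "smooth_on ?S (\<lambda>x. (\<lambda>z. coord (Y (chart_inv d z)) d) ((snd d \<circ> f \<circ> chart_inv c) x))"
  proof (rule smooth_on_compose[OF S open_chart_image[OF B d assms(1)],
        of "snd d \<circ> f \<circ> chart_inv c" "\<lambda>z. coord (Y (chart_inv d z)) d"])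
    show "smooth_on ?S (snd d \<circ> f \<circ> chart_inv c)"
      using smooth_on_map[OF A B f c d] by (rule smooth_on_subset) auto
    have "V \<inter> fst d \<inter> id -` fst d = V \<inter> fst d" by auto
    then show "smooth_on (snd d ` (V \<inter> fst d)) (\<lambda>z. coord (Y (chart_inv d z)) d)"
      using assms d unfolding smooth_section_def by metis
  qed (use c in \<open>auto simp: chart_inv_coord[OF A]\<close>)
  then show "smooth_on ?S (\<lambda>x. coord (Y (f (chart_inv c x))) d)"
    by (rule smooth_on_cong[OF S])
      (use c d in \<open>auto simp: chart_inv_coord[OF A] chart_inv_coord[OF B]\<close>)
qed (use assms in \<open>auto simp: smooth_section_def\<close>)

lemma smooth_section_coord_vec:
  "d \<in> B \<Longrightarrow> smooth_section A B f (f -` fst d) (\<lambda>q. coord_vec B d y (f q))"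
  by (intro smooth_section_compose open_chart_domain[OF B] smooth_field_coord_vec[OF B])

lemma smooth_fun_coord:
  assumes "open U" "U \<subseteq> f -` fst d" "smooth_section A B f U W" "d \<in> B"
  shows "smooth_fun A U (\<lambda>q. coord (W q) d \<bullet> b)"
  unfolding smooth_fun_def o_def
proof
  fix c assume c: "c \<in> A"
  have eq: "U \<inter> fst c \<inter> f -` fst d = U \<inter> fst c"
    using assms(2) by auto
  have "smooth_on (snd c ` (U \<inter> fst c)) (\<lambda>x. coord (W (chart_inv c x)) d)"
    using assms(3,4) c eq unfolding smooth_section_def by metis
  then show "smooth_on (snd c ` (U \<inter> fst c)) (\<lambda>x. coord (W (chart_inv c x)) d \<bullet> b)"
    using open_chart_image[OF A c assms(1)] by (auto intro: smooth_on_inner smooth_on_const)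
qed

lemma smooth_section_differential:
  assumes U: "open U" and X: "smooth_field A U X"
  shows "smooth_section A B f U (\<lambda>q. differential A B f q (X q))"
  unfolding smooth_section_def
proof (intro conjI ballI)
  fix c d assume c: "c \<in> A" and d: "d \<in> B"
  let ?S = "snd c ` (U \<inter> fst c \<inter> f -` fst d)"
  have S: "open ?S" by (rule open_chart_map[OF A B f c d U])
  have "smooth_on ?S (\<lambda>x. frechet_derivative (snd d \<circ> f \<circ> chart_inv c) (at x)
      (coord (X (chart_inv c x)) c))"
  proof (rule smooth_on_frechet_derivative_apply[OF S])
    show "smooth_on ?S (snd d \<circ> f \<circ> chart_inv c)"
      using smooth_on_map[OF A B f c d] by (rule smooth_on_subset) auto
    have "smooth_on (snd c ` (U \<inter> fst c \<inter> id -` fst c)) (\<lambda>x. coord (X (chart_inv c x)) c)"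
      using X c unfolding smooth_section_def by blast
    then show "smooth_on ?S (\<lambda>x. coord (X (chart_inv c x)) c)"
      by (rule smooth_on_subset) auto
  qed
  then show "smooth_on ?S (\<lambda>x. coord (differential A B f (chart_inv c x) (X (chart_inv c x))) d)"
  proof (rule smooth_on_cong[OF S])
    fix x assume "x \<in> ?S"
    then obtain q where q: "q \<in> U" "q \<in> fst c" "f q \<in> fst d" "x = snd c q" by auto
    then have "coord (differential A B f q (X q)) d
        = frechet_derivative (snd d \<circ> f \<circ> chart_inv c) (at (snd c q)) (coord (X q) c)"
      using c d smooth_sectionD[OF X]
      by (intro coord_differential[OF A B f]) (auto simp: charts_at_def)
    then show "frechet_derivative (snd d \<circ> f \<circ> chart_inv c) (at x) (coord (X (chart_inv c x)) c)
        = coord (differential A B f (chart_inv c x) (X (chart_inv c x))) d"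
      using q c by (simp add: chart_inv_coord[OF A])
  qed
qed (use smooth_sectionD[OF X] in \<open>auto intro: differential_in_tangent_space[OF A B f]\<close>)

text \<open>Being determined by its values on the coordinate fields, a fibrewise linear expression in a
  section along \<open>f\<close> inherits smoothness from the ambient manifold.\<close>

lemma smooth_fun_apply_linear:
  assumes L: "\<And>q. q \<in> U \<Longrightarrow> linear_between (tangent_space B (f q)) UNIV (L q :: _ \<Rightarrow> real)"
    and U: "open U" and W: "smooth_section A B f U W"
    and E: "\<And>d y. d \<in> B \<Longrightarrow> smooth_fun A (U \<inter> f -` fst d) (\<lambda>q. L q (coord_vec B d y (f q)))"
  shows "smooth_fun A U (\<lambda>q. L q (W q))"
proof (rule smooth_fun_local[OF A])
  fix p assume p: "p \<in> U"
  obtain d where d: "d \<in> B" "f p \<in> fst d"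
    using ex_chart[OF B, of "f p"] charts_atD by metis
  let ?V = "U \<inter> f -` fst d"
  have V: "open ?V"
    using U open_vimage_smooth_map[OF A B f open_chart_domain[OF B d(1)]] by (rule open_Int)
  have "smooth_fun A ?V (\<lambda>q. \<Sum>b\<in>Basis. (coord (W q) d \<bullet> b) * L q (coord_vec B d b (f q)))"
    using d(1)
    by (intro smooth_fun_sum[OF A V] smooth_fun_mult[OF A V] smooth_fun_coord[OF V] E
        smooth_section_subset[OF W]) auto
  then have "smooth_fun A ?V (\<lambda>q. L q (W q))"
  proof (rule smooth_fun_cong[OF A V])
    fix q assume q: "q \<in> ?V"
    then have d': "d \<in> charts_at B (f q)" using d by (simp add: charts_at_def)
    have "L q (\<Sum>b\<in>Basis. (coord (W q) d \<bullet> b) *\<^sub>R coord_vec B d b (f q))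
        = (\<Sum>b\<in>Basis. (coord (W q) d \<bullet> b) *\<^sub>R L q (coord_vec B d b (f q)))"
      using q by (intro linear_between_sum[OF L subspace_tangent_space[OF B]]
          coord_vec_in_tangent_space[OF B d']) auto
    then show "(\<Sum>b\<in>Basis. (coord (W q) d \<bullet> b) * L q (coord_vec B d b (f q))) = L q (W q)"
      using coord_vec_expansion[OF B smooth_sectionD[OF W, of q] d'] q by simp
  qed
  then show "\<exists>V. open V \<and> p \<in> V \<and> smooth_fun A V (\<lambda>q. L q (W q))"
    using V p d by blast
qed

text \<open>The vector-valued companion. It extends smoothness of \<phi> from ambient fields to
  sections along \<open>f\<close>, which need not be restrictions of ambient fields since
  \<open>f\<close> may identify points.\<close>

lemma smooth_section_apply_linear:
  assumes L: "\<And>q. q \<in> U \<Longrightarrow> linear_between (tangent_space B (f q)) (tangent_space B (f q)) (L q)"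
    and U: "open U" and W: "smooth_section A B f U W"
    and E: "\<And>d y. d \<in> B \<Longrightarrow> smooth_section A B f (U \<inter> f -` fst d) (\<lambda>q. L q (coord_vec B d y (f q)))"
  shows "smooth_section A B f U (\<lambda>q. L q (W q))"
proof (rule smooth_section_local)
  fix p assume p: "p \<in> U"
  obtain d where d: "d \<in> B" "f p \<in> fst d"
    using ex_chart[OF B, of "f p"] charts_atD by metis
  let ?V = "U \<inter> f -` fst d"
  have V: "open ?V"
    using U open_vimage_smooth_map[OF A B f open_chart_domain[OF B d(1)]] by (rule open_Int)
  have "smooth_section A B f ?V
      (\<lambda>q. \<Sum>b\<in>Basis. (coord (W q) d \<bullet> b) *\<^sub>R L q (coord_vec B d b (f q)))"
    using d(1)
    by (intro smooth_section_sum[OF V] smooth_section_scaleR[OF V] smooth_fun_coord[OF V] E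
        smooth_section_subset[OF W]) auto
  then have "smooth_section A B f ?V (\<lambda>q. L q (W q))"
  proof (rule smooth_section_cong[OF V])
    fix q assume q: "q \<in> ?V"
    then have d': "d \<in> charts_at B (f q)" using d by (simp add: charts_at_def)
    have "L q (\<Sum>b\<in>Basis. (coord (W q) d \<bullet> b) *\<^sub>R coord_vec B d b (f q))
        = (\<Sum>b\<in>Basis. (coord (W q) d \<bullet> b) *\<^sub>R L q (coord_vec B d b (f q)))"
      using q by (intro linear_between_sum[OF L subspace_tangent_space[OF B]]
          coord_vec_in_tangent_space[OF B d']) auto
    then show "(\<Sum>b\<in>Basis. (coord (W q) d \<bullet> b) *\<^sub>R L q (coord_vec B d b (f q))) = L q (W q)"
      using coord_vec_expansion[OF B smooth_sectionD[OF W, of q] d'] q by simp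
  qed
  then show "\<exists>V. open V \<and> p \<in> V \<and> smooth_section A B f V (\<lambda>q. L q (W q))"
    using V p d by blast
qed

end

section \<open>Extension of sections\<close>

context
  fixes A :: "('m::{t2_space, second_countable_topology}, 'a::euclidean_space) chart set"
  assumes A: "smooth_atlas A"
begin

text \<open>A closed \<open>K\<close> inside \<open>U\<close>, and not mere vanishing off
  \<open>U\<close>, is what permits extension by zero: \<open>U\<close> and the complement of
  \<open>K\<close> are then an open cover.\<close>

lemma manifold_bump:
  fixes p :: 'm
  assumes "open U" "p \<in> U"
  obtains h K where "smooth_fun A UNIV h" "h p = 1" "closed K" "K \<subseteq> U" "\<And>q. q \<notin> K \<Longrightarrow> h q = 0"
proof -
  obtain c where c: "c \<in> A" "p \<in> fst c"
    using ex_chart[OF A] charts_atD by metis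
  obtain r where r: "r > 0" "cball (snd c p) r \<subseteq> snd c ` (U \<inter> fst c)"
    using open_chart_image[OF A c(1) assms(1)] assms(2) c(2) by (metis IntI image_eqI open_contains_cball)
  obtain \<beta> where \<beta>: "smooth_on UNIV \<beta>" "\<beta> (snd c p) = (1::real)"
    "\<And>x. x \<notin> cball (snd c p) r \<Longrightarrow> \<beta> x = 0"
    using euclidean_bump[OF r(1)] by metis
  define h where "h q = (if q \<in> fst c then \<beta> (snd c q) else 0)" for q
  define K where "K = chart_inv c ` cball (snd c p) r"
  have "continuous_on (snd c ` fst c) (chart_inv c)"
    using chart_homeomorphism[OF A c(1)] by (simp add: homeomorphism_def)
  then have "continuous_on (cball (snd c p) r) (chart_inv c)"
    by (rule continuous_on_subset) (use r in auto)
  \<comment> \<open>The Hausdorff property enters here: a compact set is closed in the whole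
    manifold and not only in the chart domain.\<close>
  then have K: "closed K"
    unfolding K_def by (intro compact_imp_closed compact_continuous_image) auto
  have KU: "K \<subseteq> U \<inter> fst c"
    using r(2) by (auto simp: K_def chart_inv_coord[OF A c(1)] subset_iff image_iff)
  have h0: "h q = 0" if "q \<notin> K" for q
    using that \<beta>(3)[of "snd c q"] chart_inv_coord[OF A c(1), of q] by (force simp: h_def K_def)
  have "smooth_fun A UNIV h"
  proof (rule smooth_fun_local[OF A])
    fix q
    have "smooth_fun A (fst c) h"
      unfolding smooth_fun_def
    proof
      fix e assume e: "e \<in> A"
      have S: "open (snd e ` (fst c \<inter> fst e))"
        using open_chart_image[OF A e open_chart_domain[OF A c(1)]] .
      have "smooth_on (snd e ` (fst c \<inter> fst e)) (snd c \<circ> chart_inv e)"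
        using A c(1) e unfolding smooth_atlas_def by (metis Int_commute)
      then have "smooth_on (snd e ` (fst c \<inter> fst e)) (\<lambda>x. \<beta> ((snd c \<circ> chart_inv e) x))"
        by (rule smooth_on_compose[OF S open_UNIV subset_UNIV _ \<beta>(1)])
      then show "smooth_on (snd e ` (fst c \<inter> fst e)) (h \<circ> chart_inv e)"
        by (rule smooth_on_cong[OF S]) (use e in \<open>auto simp: h_def chart_inv_coord[OF A]\<close>)
    qed
    moreover have "smooth_fun A (- K) h"
      by (rule smooth_fun_cong[OF A _ smooth_fun_const[OF A]]) (use K h0 in auto)
    moreover have "q \<in> fst c \<or> q \<in> - K" using KU by auto
    ultimately show "\<exists>V. open V \<and> q \<in> V \<and> smooth_fun A V h"
      using K open_chart_domain[OF A c(1)] by (metis open_Compl)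
  qed
  then show ?thesis
    using that[of h K] K KU h0 c \<beta>(2) by (auto simp: h_def)
qed

end

section \<open>Global sections with a prescribed value\<close>

context
  fixes A :: "('m::{t2_space, second_countable_topology}, 'a::euclidean_space) chart set"
    and B :: "('n::{t2_space, second_countable_topology}, 'b::euclidean_space) chart set"
    and f :: "'m \<Rightarrow> 'n"
  assumes A: "smooth_atlas A" and B: "smooth_atlas B" and f: "smooth_map A B f"
begin

text \<open>Only the value at \<open>p\<close> is preserved, not the germ; this suffices because the
  final argument prescribes the test field at one point only.\<close>

lemma extend_section:
  assumes "open U" "p \<in> U" "smooth_section A B f U W"
  obtains W' where "smooth_section A B f UNIV W'" "W' p = W p"
proof -
  obtain h K where h: "smooth_fun A UNIV h" "h p = 1" "closed K" "K \<subseteq> U" "\<And>q. q \<notin> K \<Longrightarrow> h q = 0"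
    using manifold_bump[OF A assms(1,2)] by metis
  have "smooth_section A B f UNIV (\<lambda>q. h q *\<^sub>R W q)"
  proof (rule smooth_section_local[OF A B f])
    fix q
    have "smooth_section A B f U (\<lambda>q. h q *\<^sub>R W q)"
      using smooth_section_scaleR[OF A B f assms(1) smooth_fun_subset[OF A h(1)] assms(3)] by auto
    moreover have "smooth_section A B f (- K) (\<lambda>q. h q *\<^sub>R W q)"
      by (rule smooth_section_cong[OF A B f _ smooth_section_zero[OF A B f]]) (use h in auto)
    moreover have "q \<in> U \<or> q \<in> - K" using h(4) by auto
    ultimately show "\<exists>V. open V \<and> q \<in> V \<and> smooth_section A B f V (\<lambda>q. h q *\<^sub>R W q)"
      using assms(1) h(3) by (metis open_Compl)
  qed
  then show ?thesis using that h(2) by auto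
qed

lemma extend_vector:
  assumes "w \<in> tangent_space B (f p)"
  obtains W where "smooth_section A B f UNIV W" "W p = w"
proof -
  obtain d where d: "d \<in> charts_at B (f p)" using ex_chart[OF B] .
  have "coord_vec B d (coord w d) (f p) = w"
    using d assms
    by (intro tangent_eqI[OF B, of _ "f p" _ d])
      (auto simp: coord_coord_vec[OF B] coord_vec_in_tangent_space[OF B])
  moreover have dB: "d \<in> B" and p: "p \<in> f -` fst d"
    using d by (auto simp: charts_at_def)
  ultimately show ?thesis
    using extend_section[OF open_vimage_smooth_map[OF A B f open_chart_domain[OF B dB]] p
        smooth_section_coord_vec[OF A B f dB, of "coord w d"]] that by metis
qed

end


section \<open>Riemannian metrics along a map\<close>

lemma linear_betweenD:
  assumes "linear_between S T L" "x \<in> S"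
  shows "L x \<in> T" "y \<in> S \<Longrightarrow> L (x + y) = L x + L y" "L (r *\<^sub>R x) = r *\<^sub>R L x"
  using assms unfolding linear_between_def by blast+

lemma linear_between_diff:
  assumes "linear_between S T L" "subspace S" "x \<in> S" "y \<in> S"
  shows "L (x - y) = L x - L y"
  using linear_betweenD(2)[OF assms(1) subspace_diff[OF assms(2-4)] assms(4)] by simp

text \<open>Indexing by \<open>Basis\<close> matches the frame with the coordinate fields that are
  orthogonalised. Lengths are left free, so coefficients are quotients by
  \<open>g q (Y b q) (Y b q)\<close>.\<close>

definition orthogonal_frame ::
  "('m::topological_space, 'a::euclidean_space) chart set \<Rightarrow>
   ('m \<Rightarrow> ('m, 'a) tvec \<Rightarrow> ('m, 'a) tvec \<Rightarrow> real) \<Rightarrow> 'm set \<Rightarrow> ('a \<Rightarrow> 'm \<Rightarrow> ('m, 'a) tvec) \<Rightarrow> bool" where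
  "orthogonal_frame A g U Y \<longleftrightarrow> (\<forall>b\<in>Basis. smooth_field A U (Y b)) \<and>
     (\<forall>q\<in>U. (\<forall>b\<in>Basis. Y b q \<noteq> 0) \<and>
        (\<forall>b\<in>Basis. \<forall>b'\<in>Basis. b \<noteq> b' \<longrightarrow> g q (Y b q) (Y b' q) = 0) \<and>
        tangent_space A q \<subseteq> span ((\<lambda>b. Y b q) ` Basis))"

section \<open>Inner products of sections and orthogonal frames\<close>

context
  fixes B :: "('n::{t2_space, second_countable_topology}, 'b::euclidean_space) chart set"
    and g :: "'n \<Rightarrow> ('n, 'b) tvec \<Rightarrow> ('n, 'b) tvec \<Rightarrow> real"
  assumes B: "smooth_atlas B" and g: "riemannian_metric B g"
begin

lemma metric_linear_right:
  "u \<in> tangent_space B p \<Longrightarrow> linear_between (tangent_space B p) UNIV (g p u)"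
  using g by (simp add: riemannian_metric_def)

lemma metric_sym:
  "u \<in> tangent_space B p \<Longrightarrow> v \<in> tangent_space B p \<Longrightarrow> g p u v = g p v u"
  using g by (simp add: riemannian_metric_def)

lemma metric_pos: "u \<in> tangent_space B p \<Longrightarrow> u \<noteq> 0 \<Longrightarrow> g p u u > 0"
  using g by (simp add: riemannian_metric_def)

lemma metric_eq_zeroD: "u \<in> tangent_space B p \<Longrightarrow> g p u u = 0 \<Longrightarrow> u = 0"
  using metric_pos by (metis less_irrefl)

lemma metric_linear_left:
  assumes "v \<in> tangent_space B p"
  shows "linear_between (tangent_space B p) UNIV (\<lambda>u. g p u v)"
  unfolding linear_between_def
proof (intro conjI ballI allI)
  fix x y assume *: "x \<in> tangent_space B p" "y \<in> tangent_space B p"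
  show "g p (x + y) v = g p x v + g p y v"
    using metric_sym[OF assms] linear_betweenD(2)[OF metric_linear_right[OF assms] *] *
      subspace_add[OF subspace_tangent_space[OF B] *] by simp
next
  fix x r assume *: "x \<in> tangent_space B p"
  show "g p (r *\<^sub>R x) v = r *\<^sub>R g p x v"
    using metric_sym[OF assms] linear_betweenD(3)[OF metric_linear_right[OF assms] *] *
      subspace_scale[OF subspace_tangent_space[OF B] *] by simp
qed auto

lemma smooth_fun_metric_fields:
  "open U \<Longrightarrow> smooth_field B U X \<Longrightarrow> smooth_field B U Y \<Longrightarrow> smooth_fun B U (\<lambda>q. g q (X q) (Y q))"
  using g by (simp add: riemannian_metric_def)

text \<open>The metric is known to be smooth only on ambient fields. Linearity in one slot at a time
  reduces the claim to two coordinate fields, possibly of different charts, on the overlap of their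
  domains.\<close>

lemma smooth_fun_metric:
  fixes A :: "('m::{t2_space, second_countable_topology}, 'a::euclidean_space) chart set"
  assumes A: "smooth_atlas A" and f: "smooth_map A B f" and U: "open U"
    and V: "smooth_section A B f U V" and W: "smooth_section A B f U W"
  shows "smooth_fun A U (\<lambda>q. g (f q) (V q) (W q))"
proof (rule smooth_fun_apply_linear[OF A B f _ U W])
  fix d :: "('n, 'b) chart" and y assume d: "d \<in> B"
  let ?U = "U \<inter> f -` fst d"
  have U': "open ?U"
    using U open_vimage_smooth_map[OF A B f open_chart_domain[OF B d]] by (rule open_Int)
  show "smooth_fun A ?U (\<lambda>q. g (f q) (V q) (coord_vec B d y (f q)))"
  proof (rule smooth_fun_apply_linear[OF A B f _ U' smooth_section_subset[OF A B f V],
        of "\<lambda>q v. g (f q) v (coord_vec B d y (f q))"])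
    fix d' :: "('n, 'b) chart" and y' assume d': "d' \<in> B"
    have S: "open (fst d \<inter> fst d')"
      using d d' open_chart_domain[OF B] by blast
    have "smooth_field B (fst d \<inter> fst d') (coord_vec B d y)"
      "smooth_field B (fst d \<inter> fst d') (coord_vec B d' y')"
      using smooth_section_subset[OF B B smooth_map_id[OF B] smooth_field_coord_vec[OF B]] d d' by auto
    then have "smooth_fun A (f -` (fst d \<inter> fst d'))
        (\<lambda>q. g (f q) (coord_vec B d' y' (f q)) (coord_vec B d y (f q)))"
      by (intro smooth_fun_compose[OF A B f S] smooth_fun_metric_fields S)
    then show "smooth_fun A (?U \<inter> f -` fst d')
        (\<lambda>q. g (f q) (coord_vec B d' y' (f q)) (coord_vec B d y (f q)))"
      by (rule smooth_fun_subset[OF A]) auto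
  qed (use d in \<open>auto simp: charts_at_def intro!: metric_linear_left coord_vec_in_tangent_space[OF B]\<close>)
qed (intro metric_linear_right smooth_sectionD[OF V])

text \<open>Gram--Schmidt without normalisation, so that only division is needed.\<close>

lemma ex_orthogonal_frame:
  assumes c: "c \<in> B"
  shows "\<exists>Y. orthogonal_frame B g (fst c) Y"
proof -
  \<comment> \<open>The last clause is triangularity: the fields built so far have coordinates in
    the directions of \<open>I\<close> only. The next field then has coordinate 1 in its own new
    direction, which proves it nonzero without an argument on linear independence.\<close>
  define P where "P I Y \<longleftrightarrow> (\<forall>b\<in>I. smooth_field B (fst c) (Y b)) \<and>
      (\<forall>q\<in>fst c. \<forall>b\<in>I. Y b q \<noteq> 0 \<and> (\<forall>b'\<in>I. b \<noteq> b' \<longrightarrow> g q (Y b q) (Y b' q) = 0) \<and>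
        coord_vec B c b q \<in> span ((\<lambda>b. Y b q) ` I) \<and>
        (\<forall>e\<in>Basis - I. coord (Y b q) c \<bullet> e = 0))" for I :: "'b set" and Y
  have "\<exists>Y. P I Y"
    if "finite I" "I \<subseteq> Basis" for I
    using that
  proof (induction I rule: finite_induct)
    case (insert x I)
    then obtain Y where "P I Y" by auto
    then have Y: "\<And>b. b \<in> I \<Longrightarrow> smooth_field B (fst c) (Y b)"
      "\<And>q b. q \<in> fst c \<Longrightarrow> b \<in> I \<Longrightarrow> Y b q \<noteq> 0"
      "\<And>q b b'. q \<in> fst c \<Longrightarrow> b \<in> I \<Longrightarrow> b' \<in> I \<Longrightarrow> b \<noteq> b' \<Longrightarrow> g q (Y b q) (Y b' q) = 0"
      "\<And>q b. q \<in> fst c \<Longrightarrow> b \<in> I \<Longrightarrow> coord_vec B c b q \<in> span ((\<lambda>b. Y b q) ` I)"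
      "\<And>q b e. q \<in> fst c \<Longrightarrow> b \<in> I \<Longrightarrow> e \<in> Basis \<Longrightarrow> e \<notin> I \<Longrightarrow> coord (Y b q) c \<bullet> e = 0"
      unfolding P_def by blast+
    let ?E = "coord_vec B c x"
    define r where "r b q = g q (?E q) (Y b q) / g q (Y b q) (Y b q)" for b q
    define Z where "Z q = ?E q - (\<Sum>b\<in>I. r b q *\<^sub>R Y b q)" for q
    have op: "open (fst c)" using open_chart_domain[OF B c] .
    have YT: "Y b q \<in> tangent_space B q" if "b \<in> I" "q \<in> fst c" for b q
      using smooth_sectionD[OF Y(1)] that by fastforce
    have cq: "c \<in> charts_at B q" if "q \<in> fst c" for q
      using c that by (simp add: charts_at_def)
    have ET: "?E q \<in> tangent_space B q" if "q \<in> fst c" for q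
      using coord_vec_in_tangent_space[OF B cq[OF that]] .
    have ST: "(\<Sum>b\<in>I. r b q *\<^sub>R Y b q) \<in> tangent_space B q" if "q \<in> fst c" for q
      using YT that by (intro subspace_sum subspace_scale subspace_tangent_space[OF B])
    have ZT: "Z q \<in> tangent_space B q" if "q \<in> fst c" for q
      unfolding Z_def using ET ST that by (intro subspace_diff subspace_tangent_space[OF B])
    have "smooth_fun B (fst c) (r b)" if "b \<in> I" for b
      unfolding r_def
    proof (rule smooth_fun_divide[OF B op])
      show "g q (Y b q) (Y b q) \<noteq> 0" if "q \<in> fst c" for q
        using metric_pos[OF YT Y(2)] that \<open>b \<in> I\<close> by (metis less_irrefl)
    qed (intro smooth_fun_metric_fields op Y(1) that smooth_field_coord_vec[OF B c])+
    then have Z1: "smooth_field B (fst c) Z"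
      unfolding Z_def using Y(1) op
      by (intro smooth_section_diff[OF B B smooth_map_id[OF B]]
          smooth_section_sum[OF B B smooth_map_id[OF B]]
          smooth_section_scaleR[OF B B smooth_map_id[OF B]] smooth_field_coord_vec[OF B c])
    have Zcoord: "coord (Z q) c \<bullet> e = x \<bullet> e" if "q \<in> fst c" "e \<in> Basis" "e \<notin> I" for q e
      using Y(5)[OF that(1) _ that(2,3)] coord_coord_vec[OF B cq[OF that(1)]]
      by (simp add: Z_def inner_diff_left inner_sum_left)
    have ZY: "g q (Z q) (Y b q) = 0" if "q \<in> fst c" "b \<in> I" for q b
    proof -
      note lin = metric_linear_left[OF YT[OF that(2,1)]] and sub = subspace_tangent_space[OF B]
      have "g q (Z q) (Y b q) = g q (?E q) (Y b q) - (\<Sum>b'\<in>I. r b' q *\<^sub>R g q (Y b' q) (Y b q))"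
        unfolding Z_def
        using linear_between_diff[OF lin sub ET[OF that(1)] ST[OF that(1)]]
          linear_between_sum[OF lin sub, of I "\<lambda>b. Y b q" "\<lambda>b. r b q"] YT that by simp
      also have "(\<Sum>b'\<in>I. r b' q *\<^sub>R g q (Y b' q) (Y b q))
          = (\<Sum>b'\<in>I. if b' = b then r b q *\<^sub>R g q (Y b q) (Y b q) else 0)"
        using Y(3)[OF that(1) _ that(2)] by (intro sum.cong) auto
      also have "\<dots> = g q (?E q) (Y b q)"
        using insert(1) that metric_pos[OF YT[OF that(2,1)] Y(2)[OF that]] by (simp add: r_def)
      finally show ?thesis by simp
    qed
    have x: "x \<in> Basis" "x \<notin> I" using insert by auto
    have Z0: "Z q \<noteq> 0" if "q \<in> fst c" for q
      using Zcoord[OF that x] x by (auto simp: inner_Basis)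
    have Zspan: "?E q \<in> span (insert (Z q) ((\<lambda>b. Y b q) ` I))" for q
    proof -
      have "?E q = Z q + (\<Sum>b\<in>I. r b q *\<^sub>R Y b q)" by (simp add: Z_def)
      then show ?thesis
        by (auto intro!: span_add[OF span_base span_sum] span_scale intro: span_base)
    qed
    have Yspan: "coord_vec B c b q \<in> span (insert (Z q) ((\<lambda>b. Y b q) ` I))"
      if "q \<in> fst c" "b \<in> I" for q b
      using Y(4)[OF that] span_mono[OF subset_insertI] by blast
    have im: "(\<lambda>b. (Y(x := Z)) b q) ` insert x I = insert (Z q) ((\<lambda>b. Y b q) ` I)" for q
      using x(2) by auto
    show ?case
      unfolding P_def
    proof (intro exI[of _ "Y(x := Z)"] conjI ballI impI)
      fix q b assume q: "q \<in> fst c" and b: "b \<in> insert x I"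
      show "(Y(x := Z)) b q \<noteq> 0" using q b Z0 Y(2) by auto
      show "coord_vec B c b q \<in> span ((\<lambda>b. (Y(x := Z)) b q) ` insert x I)"
        unfolding im using q b Zspan Yspan by auto
      show "coord ((Y(x := Z)) b q) c \<bullet> e = 0" if "e \<in> Basis - insert x I" for e
        using q b that x Zcoord[OF q, of e] Y(5)[OF q, of b e] by (auto simp: inner_Basis)
      show "g q ((Y(x := Z)) b q) ((Y(x := Z)) b' q) = 0" if "b' \<in> insert x I" "b \<noteq> b'" for b'
        using q b that ZY[OF q] Y(3)[OF q] metric_sym[OF ZT[OF q] YT[OF _ q]] by auto
    qed (use Z1 Y(1) in auto)
  qed (unfold P_def, simp)
  from this[OF finite_Basis order_refl] obtain Y where "P Basis Y" by blast
  then have Y: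
    "\<And>b. b \<in> Basis \<Longrightarrow> smooth_field B (fst c) (Y b)"
    "\<And>q b. q \<in> fst c \<Longrightarrow> b \<in> Basis \<Longrightarrow> Y b q \<noteq> 0"
    "\<And>q b b'. q \<in> fst c \<Longrightarrow> b \<in> Basis \<Longrightarrow> b' \<in> Basis \<Longrightarrow> b \<noteq> b' \<Longrightarrow> g q (Y b q) (Y b' q) = 0"
    "\<And>q b. q \<in> fst c \<Longrightarrow> b \<in> Basis \<Longrightarrow> coord_vec B c b q \<in> span ((\<lambda>b::'b. Y b q) ` Basis)"
    unfolding P_def by blast+
  have "u \<in> span ((\<lambda>b::'b. Y b q) ` Basis)" if "q \<in> fst c" "u \<in> tangent_space B q" for q u
    using c that Y(4)[OF that(1)]
    by (subst coord_vec_expansion[OF B that(2), of c])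
      (auto simp: charts_at_def intro!: span_sum span_scale)
  then show ?thesis
    using Y(1-3) unfolding orthogonal_frame_def by (intro exI[of _ Y]) blast
qed

end

section \<open>Tangential and normal parts\<close>

context
  fixes A :: "('m::{t2_space, second_countable_topology}, 'a::euclidean_space) chart set"
    and B :: "('n::{t2_space, second_countable_topology}, 'b::euclidean_space) chart set"
    and f :: "'m \<Rightarrow> 'n"
    and gM :: "'m \<Rightarrow> ('m, 'a) tvec \<Rightarrow> ('m, 'a) tvec \<Rightarrow> real"
    and g :: "'n \<Rightarrow> ('n, 'b) tvec \<Rightarrow> ('n, 'b) tvec \<Rightarrow> real"
  assumes A: "smooth_atlas A" and B: "smooth_atlas B"
    and gM: "riemannian_metric A gM" and g: "riemannian_metric B g"
    and iso: "isometric_immersion A B f gM g"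
begin

lemma immersion_smooth_map: "smooth_map A B f"
  using iso by (simp add: isometric_immersion_def)

lemmas df_lin = linear_differential[OF A B immersion_smooth_map]
  and df_in = differential_in_tangent_space[OF A B immersion_smooth_map]

lemma df_isometric:
  "u \<in> tangent_space A p \<Longrightarrow> v \<in> tangent_space A p \<Longrightarrow>
    g (f p) (differential A B f p u) (differential A B f p v) = gM p u v"
  using iso by (simp add: isometric_immersion_def)

lemma subspace_normal_space: "subspace (normal_space A B f g p)"
proof (rule subspaceI)
  show "0 \<in> normal_space A B f g p"
    using linear_betweenD(3)[OF metric_linear_left[OF B g df_in], of _ p 0 0]
      subspace_0[OF subspace_tangent_space[OF B]] by (simp add: normal_space_def)
next
  fix x y assume "x \<in> normal_space A B f g p" "y \<in> normal_space A B f g p"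
  then show "x + y \<in> normal_space A B f g p"
    using linear_betweenD(2)[OF metric_linear_left[OF B g df_in], of _ p x y]
    by (auto simp: normal_space_def intro: subspace_add[OF subspace_tangent_space[OF B]])
next
  fix r x assume "x \<in> normal_space A B f g p"
  then show "r *\<^sub>R x \<in> normal_space A B f g p"
    using linear_betweenD(3)[OF metric_linear_left[OF B g df_in], of _ p x r]
    by (auto simp: normal_space_def intro: subspace_scale[OF subspace_tangent_space[OF B]])
qed

text \<open>Uniqueness: for two candidates, the image of the difference is both tangent and normal,
  hence of length zero; by isometry the difference has length zero for \<open>gM\<close>, which is
  definite.\<close>

lemma tan_part_eqI:
  assumes u: "u \<in> tangent_space A p" and n: "w - differential A B f p u \<in> normal_space A B f g p"
  shows "tan_part A B f g p w = u"
  unfolding tan_part_def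
proof (rule the_equality)
  fix u' assume u': "u' \<in> tangent_space A p \<and> w - differential A B f p u' \<in> normal_space A B f g p"
  let ?x = "u' - u" and ?d = "differential A B f p"
  have x: "?x \<in> tangent_space A p"
    using u u' subspace_diff[OF subspace_tangent_space[OF A]] by blast
  have "?d ?x = (w - ?d u) - (w - ?d u')"
    by (simp add: linear_diff[OF df_lin])
  then have "g (f p) (?d ?x) (?d ?x) = g (f p) (w - ?d u) (?d ?x) - g (f p) (w - ?d u') (?d ?x)"
    using linear_between_diff[OF metric_linear_left[OF B g df_in[OF x]] subspace_tangent_space[OF B],
        of "w - ?d u" "w - ?d u'"] n u' by (simp add: normal_space_def)
  then have "gM p ?x ?x = 0"
    using df_isometric[OF x x] n u' x by (simp add: normal_space_def)
  then show "u' = u"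
    using metric_eq_zeroD[OF A gM x] by simp
qed (use assms in auto)

text \<open>Fourier coefficients with respect to the frame. This provides the existence of the
  projection and, at the same time, a formula from which its smoothness is read off.\<close>

lemma tan_part_orthogonal_frame:
  assumes frame: "orthogonal_frame A gM U Y" and q: "q \<in> U" and w: "w \<in> tangent_space B (f q)"
  shows "tan_part A B f g q w = (\<Sum>b\<in>Basis.
      (g (f q) w (differential A B f q (Y b q)) / gM q (Y b q) (Y b q)) *\<^sub>R Y b q)"
    and "w - differential A B f q (tan_part A B f g q w) \<in> normal_space A B f g q"
proof -
  let ?d = "differential A B f q"
  have YT: "Y b q \<in> tangent_space A q" if "b \<in> Basis" for b
    using frame q that smooth_sectionD[of A A id U "Y b" q] by (simp add: orthogonal_frame_def)
  have Y0: "Y b q \<noteq> 0" if "b \<in> Basis" for b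
    using frame q that by (simp add: orthogonal_frame_def)
  define r where "r b = g (f q) w (?d (Y b q)) / gM q (Y b q) (Y b q)" for b
  define t where "t = (\<Sum>b\<in>Basis. r b *\<^sub>R Y b q)"
  have tT: "t \<in> tangent_space A q"
    unfolding t_def using YT by (intro subspace_sum subspace_scale subspace_tangent_space[OF A])
  have tn: "w - ?d t \<in> normal_space A B f g q"
  proof -
    let ?n = "w - ?d t"
    have n: "?n \<in> tangent_space B (f q)"
      using w df_in[OF tT] subspace_diff[OF subspace_tangent_space[OF B]] by blast
    note lin = metric_linear_right[OF B g n]
    \<comment> \<open>The vectors whose images are orthogonal to \<open>?n\<close> form a subspace,
      so testing the frame is enough.\<close>
    have "subspace {u \<in> tangent_space A q. g (f q) ?n (?d u) = 0}"
    proof (rule subspaceI)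
      show "0 \<in> {u \<in> tangent_space A q. g (f q) ?n (?d u) = 0}"
        using linear_betweenD(3)[OF lin n, of 0] subspace_0[OF subspace_tangent_space[OF A]]
        by (simp add: linear_0[OF df_lin])
    next
      fix x y assume "x \<in> {u \<in> tangent_space A q. g (f q) ?n (?d u) = 0}"
        "y \<in> {u \<in> tangent_space A q. g (f q) ?n (?d u) = 0}"
      then show "x + y \<in> {u \<in> tangent_space A q. g (f q) ?n (?d u) = 0}"
        using linear_betweenD(2)[OF lin df_in df_in, of x y]
        by (auto simp: linear_add[OF df_lin] intro: subspace_add[OF subspace_tangent_space[OF A]])
    next
      fix s x assume "x \<in> {u \<in> tangent_space A q. g (f q) ?n (?d u) = 0}"
      then show "s *\<^sub>R x \<in> {u \<in> tangent_space A q. g (f q) ?n (?d u) = 0}"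
        using linear_betweenD(3)[OF lin df_in, of x s]
        by (auto simp: linear_scale[OF df_lin] intro: subspace_scale[OF subspace_tangent_space[OF A]])
    qed
    moreover have "g (f q) ?n (?d (Y b q)) = 0" if b: "b \<in> Basis" for b
    proof -
      have "g (f q) ?n (?d (Y b q)) = g (f q) w (?d (Y b q)) - gM q t (Y b q)"
        using linear_between_diff[OF metric_linear_left[OF B g df_in] subspace_tangent_space[OF B] w df_in,
            OF YT[OF b] tT] df_isometric[OF tT YT[OF b]] by simp
      also have "gM q t (Y b q) = (\<Sum>b'\<in>Basis. r b' *\<^sub>R gM q (Y b' q) (Y b q))"
        unfolding t_def
        by (rule linear_between_sum[OF metric_linear_left[OF A gM YT[OF b]]
              subspace_tangent_space[OF A] YT])
      also have "\<dots> = (\<Sum>b'\<in>Basis. if b' = b then r b *\<^sub>R gM q (Y b q) (Y b q) else 0)"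
        using frame q b unfolding orthogonal_frame_def by (intro sum.cong) auto
      also have "\<dots> = g (f q) w (?d (Y b q))"
        using b metric_pos[OF A gM YT[OF b] Y0[OF b]] by (simp add: r_def)
      finally show ?thesis by simp
    qed
    ultimately have "span ((\<lambda>b::'a. Y b q) ` Basis) \<subseteq> {u \<in> tangent_space A q. g (f q) ?n (?d u) = 0}"
      using YT by (intro span_minimal) auto
    moreover have "tangent_space A q \<subseteq> span ((\<lambda>b::'a. Y b q) ` Basis)"
      using frame q by (simp add: orthogonal_frame_def)
    ultimately show ?thesis
      using n by (auto simp: normal_space_def)
  qed
  have eq: "tan_part A B f g q w = t"
    using tan_part_eqI[OF tT tn] .
  then show "tan_part A B f g q w = (\<Sum>b\<in>Basis.
      (g (f q) w (?d (Y b q)) / gM q (Y b q) (Y b q)) *\<^sub>R Y b q)"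
    by (simp add: t_def r_def)
  show "w - ?d (tan_part A B f g q w) \<in> normal_space A B f g q"
    using tn by (simp add: eq)
qed

lemma nor_part_in_normal_space:
  assumes "w \<in> tangent_space B (f p)"
  shows "nor_part A B f g p w \<in> normal_space A B f g p"
proof -
  obtain c where c: "c \<in> A" "p \<in> fst c"
    using ex_chart[OF A] charts_atD by metis
  then show ?thesis
    using ex_orthogonal_frame[OF A gM c(1)] tan_part_orthogonal_frame(2) assms
    unfolding nor_part_def by blast
qed

lemma smooth_field_tan_part:
  assumes U: "open U" and W: "smooth_section A B f U W"
  shows "smooth_field A U (\<lambda>q. tan_part A B f g q (W q))"
proof (rule smooth_section_local[OF A A smooth_map_id[OF A]])
  fix p assume p: "p \<in> U"
  obtain c where c: "c \<in> A" "p \<in> fst c"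
    using ex_chart[OF A] charts_atD by metis
  let ?V = "U \<inter> fst c"
  have V: "open ?V" using U open_chart_domain[OF A c(1)] by blast
  obtain Y where frame: "orthogonal_frame A gM (fst c) Y"
    using ex_orthogonal_frame[OF A gM c(1)] by blast
  then have Y: "\<And>b. b \<in> Basis \<Longrightarrow> smooth_field A (fst c) (Y b)"
    "\<And>q b. q \<in> fst c \<Longrightarrow> b \<in> Basis \<Longrightarrow> Y b q \<noteq> 0"
    by (auto simp: orthogonal_frame_def)
  have YV: "smooth_field A ?V (Y b)" if "b \<in> Basis" for b
    using smooth_section_subset[OF A A smooth_map_id[OF A] Y(1)[OF that]] by auto
  have "gM q (Y b q) (Y b q) \<noteq> 0" if "q \<in> ?V" "b \<in> Basis" for q b
    using metric_pos[OF A gM _ Y(2)] smooth_sectionD[OF YV] that by (metis IntD2 id_apply less_irrefl)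
  then have "smooth_field A ?V (\<lambda>q. \<Sum>b\<in>Basis.
      (g (f q) (W q) (differential A B f q (Y b q)) / gM q (Y b q) (Y b q)) *\<^sub>R Y b q)"
    using YV V smooth_section_subset[OF A B immersion_smooth_map W]
    by (intro smooth_section_sum[OF A A smooth_map_id[OF A]]
        smooth_section_scaleR[OF A A smooth_map_id[OF A]] smooth_fun_divide[OF A]
        smooth_fun_metric[OF B g A immersion_smooth_map] smooth_fun_metric_fields[OF A gM]
        smooth_section_differential[OF A B immersion_smooth_map]) auto
  then have "smooth_field A ?V (\<lambda>q. tan_part A B f g q (W q))"
    by (rule smooth_section_cong[OF A A smooth_map_id[OF A] V])
      (use tan_part_orthogonal_frame(1)[OF frame] smooth_sectionD[OF W] in auto)
  then show "\<exists>V. open V \<and> p \<in> V \<and> smooth_field A V (\<lambda>q. tan_part A B f g q (W q))"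
    using V p c by blast
qed

text \<open>Tangency is part of being a smooth field, so it is obtained by extending
  \<open>w\<close> to a section and projecting that.\<close>

lemma tan_part_in_tangent_space:
  assumes "w \<in> tangent_space B (f p)"
  shows "tan_part A B f g p w \<in> tangent_space A p"
proof -
  obtain W where "smooth_section A B f UNIV W" "W p = w"
    using extend_vector[OF A B immersion_smooth_map assms] .
  then show ?thesis
    using smooth_sectionD[OF smooth_field_tan_part[OF open_UNIV], of W p] by simp
qed

lemma smooth_section_nor_part:
  assumes "open U" "smooth_section A B f U W"
  shows "smooth_section A B f U (\<lambda>q. nor_part A B f g q (W q))"
  unfolding nor_part_def
  using assms smooth_field_tan_part
  by (intro smooth_section_diff[OF A B immersion_smooth_map]
      smooth_section_differential[OF A B immersion_smooth_map])

lemma nor_part_normal: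
  assumes "w \<in> normal_space A B f g p"
  shows "nor_part A B f g p w = w"
proof -
  have "tan_part A B f g p w = 0"
    using assms by (intro tan_part_eqI)
      (auto simp: subspace_0[OF subspace_tangent_space[OF A]] linear_0[OF df_lin])
  then show ?thesis by (simp add: nor_part_def linear_0[OF df_lin])
qed

text \<open>Extend within the whole ambient tangent bundle, then project. The projection is smooth
  and leaves the value at \<open>p\<close>, already normal, unchanged.\<close>

lemma extend_normal_vector:
  assumes "w \<in> normal_space A B f g p"
  obtains W where "normal_section A B f g W" "W p = w"
proof -
  have "w \<in> tangent_space B (f p)" using assms by (simp add: normal_space_def)
  then obtain W where W: "smooth_section A B f UNIV W" "W p = w"
    using extend_vector[OF A B immersion_smooth_map] by blast
  have "normal_section A B f g (\<lambda>q. nor_part A B f g q (W q))"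
    using smooth_section_nor_part[OF open_UNIV W(1)] smooth_sectionD[OF W(1)]
    by (simp add: normal_section_def nor_part_in_normal_space)
  then show ?thesis
    using that W(2) nor_part_normal[OF assms] by simp
qed

text \<open>With its tangential counterpart below, this removes the projections from inner products;
  second fundamental form and shape operators then never have to be introduced.\<close>

lemma metric_nor_part:
  assumes "w \<in> tangent_space B (f p)" "n \<in> normal_space A B f g p"
  shows "g (f p) (nor_part A B f g p w) n = g (f p) w n"
proof -
  have n: "n \<in> tangent_space B (f p)" "g (f p) n (differential A B f p (tan_part A B f g p w)) = 0"
    using assms tan_part_in_tangent_space by (auto simp: normal_space_def)
  have t: "differential A B f p (tan_part A B f g p w) \<in> tangent_space B (f p)"
    using df_in[OF tan_part_in_tangent_space[OF assms(1)]] .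
  show ?thesis
    unfolding nor_part_def
    using linear_between_diff[OF metric_linear_left[OF B g n(1)] subspace_tangent_space[OF B] assms(1) t]
      metric_sym[OF B g t n(1)] n(2) by simp
qed

lemma metric_tan_part:
  assumes "w \<in> tangent_space B (f p)" "u \<in> tangent_space A p"
  shows "gM p (tan_part A B f g p w) u = g (f p) w (differential A B f p u)"
proof -
  have t: "tan_part A B f g p w \<in> tangent_space A p"
    by (rule tan_part_in_tangent_space[OF assms(1)])
  have "g (f p) (nor_part A B f g p w) (differential A B f p u) = 0"
    using nor_part_in_normal_space[OF assms(1)] assms(2) by (simp add: normal_space_def)
  then show ?thesis
    unfolding nor_part_def df_isometric[OF t assms(2), symmetric]
    using linear_between_diff[OF metric_linear_left[OF B g df_in[OF assms(2)]]
        subspace_tangent_space[OF B] assms(1) df_in[OF t]] by simp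
qed

end

section \<open>Connections along a map\<close>

context
  fixes A :: "('m::{t2_space, second_countable_topology}, 'a::euclidean_space) chart set"
  assumes A: "smooth_atlas A"
begin

text \<open>The selected chart depends on the point alone, so one chart serves all functions and the
  rules reduce to calculus at one Euclidean point.\<close>

lemma dir_deriv_chart:
  obtains c where "c \<in> charts_at A p"
    "\<And>u h. dir_deriv A p u h = frechet_derivative (h \<circ> chart_inv c) (at (snd c p)) (coord u c)"
  using that[OF SOME_chart[OF A]] by (simp add: dir_deriv_def Let_def)

lemma smooth_fun_has_derivative:
  assumes "p \<in> U" "smooth_fun A U h" "c \<in> charts_at A p"
  shows "(h \<circ> chart_inv c has_derivative frechet_derivative (h \<circ> chart_inv c) (at (snd c p)))
    (at (snd c p))"
proof -
  have "smooth_on (snd c ` (U \<inter> fst c)) (h \<circ> chart_inv c)"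
    using assms by (simp add: smooth_fun_def charts_at_def)
  moreover have "snd c p \<in> snd c ` (U \<inter> fst c)"
    using assms by (simp add: charts_at_def)
  ultimately show ?thesis
    unfolding frechet_derivative_works[symmetric] by (rule smooth_on_imp_differentiable)
qed

lemma dir_deriv_cong:
  assumes "open U" "p \<in> U" "smooth_fun A U h" "\<And>q. q \<in> U \<Longrightarrow> h q = k q"
  shows "dir_deriv A p u k = dir_deriv A p u h"
proof -
  obtain c where c: "c \<in> charts_at A p"
    "\<And>u h. dir_deriv A p u h = frechet_derivative (h \<circ> chart_inv c) (at (snd c p)) (coord u c)"
    using dir_deriv_chart by blast
  have "(k \<circ> chart_inv c has_derivative frechet_derivative (h \<circ> chart_inv c) (at (snd c p)))
      (at (snd c p))"
    using smooth_fun_has_derivative[OF assms(2,3) c(1)]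
    by (rule has_derivative_transform_within_open[OF _ open_chart_image[OF A _ assms(1), of c]])
      (use assms c(1) in \<open>auto simp: charts_at_def chart_inv_coord[OF A]\<close>)
  from frechet_derivative_at[OF this] show ?thesis
    by (simp add: c(2))
qed

lemma dir_deriv_const: "dir_deriv A p u (\<lambda>_. r) = 0"
  by (simp add: dir_deriv_def o_def Let_def)

lemma dir_deriv_add:
  assumes "p \<in> U" "smooth_fun A U h" "smooth_fun A U k"
  shows "dir_deriv A p u (\<lambda>q. h q + k q) = dir_deriv A p u h + dir_deriv A p u k"
proof -
  obtain c where c: "c \<in> charts_at A p"
    "\<And>u h. dir_deriv A p u h = frechet_derivative (h \<circ> chart_inv c) (at (snd c p)) (coord u c)"
    using dir_deriv_chart by blast
  have "((\<lambda>q. h q + k q) \<circ> chart_inv c has_derivative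
      (\<lambda>v. frechet_derivative (h \<circ> chart_inv c) (at (snd c p)) v
        + frechet_derivative (k \<circ> chart_inv c) (at (snd c p)) v)) (at (snd c p))"
    using has_derivative_add[OF smooth_fun_has_derivative[OF assms(1,2) c(1)]
        smooth_fun_has_derivative[OF assms(1,3) c(1)]] by (simp add: o_def)
  from fun_cong[OF frechet_derivative_at[OF this]] show ?thesis
    by (simp add: c(2))
qed

lemma dir_deriv_mult:
  assumes "p \<in> U" "smooth_fun A U h" "smooth_fun A U k"
  shows "dir_deriv A p u (\<lambda>q. h q * k q) = dir_deriv A p u h * k p + h p * dir_deriv A p u k"
proof -
  obtain c where c: "c \<in> charts_at A p"
    "\<And>u h. dir_deriv A p u h = frechet_derivative (h \<circ> chart_inv c) (at (snd c p)) (coord u c)"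
    using dir_deriv_chart by blast
  have cp: "chart_inv c (snd c p) = p"
    using c(1) by (simp add: charts_at_def chart_inv_coord[OF A])
  have "((\<lambda>q. h q * k q) \<circ> chart_inv c has_derivative
      (\<lambda>v. h p * frechet_derivative (k \<circ> chart_inv c) (at (snd c p)) v
        + frechet_derivative (h \<circ> chart_inv c) (at (snd c p)) v * k p)) (at (snd c p))"
    using has_derivative_mult[OF smooth_fun_has_derivative[OF assms(1,2) c(1)]
        smooth_fun_has_derivative[OF assms(1,3) c(1)]] by (simp add: o_def cp)
  from fun_cong[OF frechet_derivative_at[OF this], of "coord u c"] show ?thesis
    by (simp add: c(2))
qed

end

section \<open>Locality and metric compatibility of connections along a map\<close>

context
  fixes A :: "('m::{t2_space, second_countable_topology}, 'a::euclidean_space) chart set"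
    and B :: "('n::{t2_space, second_countable_topology}, 'b::euclidean_space) chart set"
    and f :: "'m \<Rightarrow> 'n"
  assumes A: "smooth_atlas A" and B: "smooth_atlas B" and f: "smooth_map A B f"
begin

text \<open>Inner products of fields \<open>Y \<circ> f\<close> can thus be differentiated on the
  ambient manifold, where metric compatibility is given.\<close>

lemma dir_deriv_compose:
  assumes "open V" "f p \<in> V" "smooth_fun B V h"
  shows "dir_deriv A p u (\<lambda>q. h (f q)) = dir_deriv B (f p) (differential A B f p u) h"
proof -
  define c where "c = (SOME c. c \<in> charts_at A p)"
  have c: "c \<in> charts_at A p" unfolding c_def by (rule SOME_chart[OF A])
  define d where "d = (SOME d. d \<in> charts_at B (f p))"
  have d: "d \<in> charts_at B (f p)" unfolding d_def by (rule SOME_chart[OF B])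
  have eq: "(snd d \<circ> f \<circ> chart_inv c) (snd c p) = snd d (f p)"
    using c by (auto simp: chart_inv_coord[OF A] charts_at_def)
  have "frechet_derivative ((\<lambda>q. h (f q)) \<circ> chart_inv c) (at (snd c p)) (coord u c)
      = frechet_derivative (h \<circ> chart_inv d) (at (snd d (f p)))
          (frechet_derivative (snd d \<circ> f \<circ> chart_inv c) (at (snd c p)) (coord u c))"
    unfolding eq[symmetric]
  proof (rule frechet_derivative_chain_open)
    show "open (snd c ` (UNIV \<inter> fst c \<inter> f -` fst d))"
      using c d open_chart_map[OF A B f _ _ open_UNIV] by (auto simp: charts_at_def)
    show "snd c p \<in> snd c ` (UNIV \<inter> fst c \<inter> f -` fst d)"
      using c d by (auto simp: charts_at_def)
    show "(snd d \<circ> f \<circ> chart_inv c) differentiable at (snd c p)"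
      by (rule map_differentiable[OF A B f c d])
    show "(h \<circ> chart_inv d) differentiable at ((snd d \<circ> f \<circ> chart_inv c) (snd c p))"
      unfolding eq using smooth_fun_has_derivative[OF B assms(2,3) d] differentiableI by blast
  qed (use c d in \<open>auto simp: charts_at_def chart_inv_coord[OF A] chart_inv_coord[OF B]\<close>)
  moreover have "coord (differential A B f p u) d
      = frechet_derivative (snd d \<circ> f \<circ> chart_inv c) (at (snd c p)) (coord u c)"
    using d by (simp add: differential_def Let_def flip: c_def)
  ultimately show ?thesis
    by (simp add: dir_deriv_def Let_def flip: c_def d_def)
qed

context
  fixes D :: "'m \<Rightarrow> ('m, 'a) tvec \<Rightarrow> ('m \<Rightarrow> ('n, 'b) tvec) \<Rightarrow> ('n, 'b) tvec"
  assumes D: "connection_along A B f D"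
begin

lemma connection_in_tangent_space:
  assumes "open U" "p \<in> U" "smooth_section A B f U W" "u \<in> tangent_space A p"
  shows "D p u W \<in> tangent_space B (f p)"
proof -
  have "linear_between (tangent_space A p) (tangent_space B (f p)) (\<lambda>u. D p u W)"
    by (rule D[unfolded connection_along_def, THEN conjunct1, rule_format, of U]) (use assms in blast)
  from linear_betweenD(1)[OF this assms(4)] show ?thesis .
qed

lemma connection_add:
  assumes "open U" "p \<in> U" "smooth_section A B f U V" "smooth_section A B f U W"
    "u \<in> tangent_space A p"
  shows "D p u (\<lambda>q. V q + W q) = D p u V + D p u W"
  by (rule D[unfolded connection_along_def, THEN conjunct2, THEN conjunct1, rule_format, of u p U])
    (use assms in blast)+

lemma connection_leibniz:
  assumes "open U" "p \<in> U" "smooth_fun A U h" "smooth_section A B f U W" "u \<in> tangent_space A p"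
  shows "D p u (\<lambda>q. h q *\<^sub>R W q) = dir_deriv A p u h *\<^sub>R W p + h p *\<^sub>R D p u W"
  by (rule D[unfolded connection_along_def, THEN conjunct2, THEN conjunct2, THEN conjunct1,
        rule_format, of u p U]) (use assms in blast)+

text \<open>Apply the Leibniz rule to the indicator function of \<open>U\<close>, which is smooth on \<open>U\<close>.\<close>

lemma connection_cong:
  assumes U: "open U" "p \<in> U" and W: "smooth_section A B f U W" and u: "u \<in> tangent_space A p"
    and eq: "\<And>q. q \<in> U \<Longrightarrow> W q = Z q"
  shows "D p u Z = D p u W"
proof -
  define h :: "'m \<Rightarrow> real" where "h q = (if q \<in> U then 1 else 0)" for q
  have h: "smooth_fun A U h"
    by (rule smooth_fun_cong[OF A U(1) smooth_fun_const[OF A U(1), of 1]]) (simp add: h_def)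
  have "dir_deriv A p u h = 0"
    using dir_deriv_cong[OF A U smooth_fun_const[OF A U(1), of 1], of h] dir_deriv_const[OF A]
    by (simp add: h_def)
  then have "D p u (\<lambda>q. h q *\<^sub>R X q) = D p u X" if "smooth_section A B f U X" for X
    using connection_leibniz[OF U h that u] U(2) by (simp add: h_def)
  \<comment> \<open>The cut-off vanishes wherever the two may differ, so these are equal as total
    functions, and \<open>D\<close> receives literally the same argument.\<close>
  moreover have "(\<lambda>q. h q *\<^sub>R W q) = (\<lambda>q. h q *\<^sub>R Z q)"
    using eq by (auto simp: h_def)
  ultimately show ?thesis
    using W smooth_section_cong[OF A B f U(1) W eq] by metis
qed

lemma connection_zero:
  assumes "u \<in> tangent_space A p"
  shows "D p u (\<lambda>_. 0) = 0"
  using connection_leibniz[OF open_UNIV UNIV_I smooth_fun_const[OF A open_UNIV, of 0]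
      smooth_section_zero[OF A B f open_UNIV] assms]
  by (simp add: dir_deriv_const[OF A])

text \<open>The defect of metric compatibility is tensorial in the section \<open>V\<close>.\<close>

lemma metric_compat_from_frame:
  fixes g :: "'n \<Rightarrow> ('n, 'b) tvec \<Rightarrow> ('n, 'b) tvec \<Rightarrow> real"
  assumes g: "riemannian_metric B g"
    and d: "d \<in> B" and U: "open U" "U \<subseteq> f -` fst d" "p \<in> U" and u: "u \<in> tangent_space A p"
    and V: "smooth_section A B f U V" and W: "smooth_section A B f U W"
    and E: "\<And>b. b \<in> Basis \<Longrightarrow> dir_deriv A p u (\<lambda>q. g (f q) (coord_vec B d b (f q)) (W q))
      = g (f p) (D p u (\<lambda>q. coord_vec B d b (f q))) (W p)
        + g (f p) (coord_vec B d b (f p)) (D p u W)"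
  shows "dir_deriv A p u (\<lambda>q. g (f q) (V q) (W q))
    = g (f p) (D p u V) (W p) + g (f p) (V p) (D p u W)"
proof -
  \<comment> \<open>The smooth sections with this property form a module over the smooth functions.
    It contains the coordinate fields by \<open>E\<close>, hence also \<open>V\<close>.\<close>
  define C where "C X \<longleftrightarrow> dir_deriv A p u (\<lambda>q. g (f q) (X q) (W q))
    = g (f p) (D p u X) (W p) + g (f p) (X p) (D p u W)" for X
  have WT: "W q \<in> tangent_space B (f q)" if "q \<in> U" for q
    using smooth_sectionD[OF W that] .
  note lin = metric_linear_left[OF B g WT]
    and lin' = metric_linear_left[OF B g connection_in_tangent_space[OF U(1,3) W u]]
    and sm = smooth_fun_metric[OF B g A f U(1) _ W]
  have C_cong: "C Y" if "C X" "smooth_section A B f U X" "\<And>q. q \<in> U \<Longrightarrow> X q = Y q" for X Y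
    using that dir_deriv_cong[OF A U(1,3) sm[OF that(2)], of "\<lambda>q. g (f q) (Y q) (W q)"]
      connection_cong[OF U(1,3) that(2) u, of Y] U(3) by (simp add: C_def)
  have C_add: "C (\<lambda>q. X q + Y q)"
    if "C X" "C Y" and X: "smooth_section A B f U X" and Y: "smooth_section A B f U Y" for X Y
  proof -
    have "dir_deriv A p u (\<lambda>q. g (f q) (X q + Y q) (W q))
        = dir_deriv A p u (\<lambda>q. g (f q) (X q) (W q) + g (f q) (Y q) (W q))"
      by (rule dir_deriv_cong[OF A U(1,3) smooth_fun_add[OF A U(1) sm[OF X] sm[OF Y]]])
        (use linear_betweenD(2)[OF lin] smooth_sectionD[OF X] smooth_sectionD[OF Y] in auto)
    also have "\<dots> = dir_deriv A p u (\<lambda>q. g (f q) (X q) (W q)) + dir_deriv A p u (\<lambda>q. g (f q) (Y q) (W q))"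
      by (rule dir_deriv_add[OF A U(3) sm[OF X] sm[OF Y]])
    finally show ?thesis
      using that connection_add[OF U(1,3) X Y u]
        linear_betweenD(2)[OF lin[OF U(3)] connection_in_tangent_space[OF U(1,3) X u]
          connection_in_tangent_space[OF U(1,3) Y u]]
        linear_betweenD(2)[OF lin' smooth_sectionD[OF X U(3)] smooth_sectionD[OF Y U(3)]]
      by (simp add: C_def)
  qed
  \<comment> \<open>The product rule on the left and the Leibniz rule for \<open>D\<close> on the
    right contribute the same term in the derivative of \<open>h\<close>.\<close>
  have C_scale: "C (\<lambda>q. h q *\<^sub>R X q)"
    if "C X" and X: "smooth_section A B f U X" and h: "smooth_fun A U h" for h X
  proof -
    have XT: "X p \<in> tangent_space B (f p)" and DX: "D p u X \<in> tangent_space B (f p)"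
      using smooth_sectionD[OF X U(3)] connection_in_tangent_space[OF U(1,3) X u] .
    have "dir_deriv A p u (\<lambda>q. g (f q) (h q *\<^sub>R X q) (W q))
        = dir_deriv A p u (\<lambda>q. h q * g (f q) (X q) (W q))"
      by (rule dir_deriv_cong[OF A U(1,3) smooth_fun_mult[OF A U(1) h sm[OF X]]])
        (use linear_betweenD(3)[OF lin] smooth_sectionD[OF X] in auto)
    also have "\<dots> = dir_deriv A p u h * g (f p) (X p) (W p)
        + h p * dir_deriv A p u (\<lambda>q. g (f q) (X q) (W q))"
      by (rule dir_deriv_mult[OF A U(3) h sm[OF X]])
    moreover have "g (f p) (dir_deriv A p u h *\<^sub>R X p + h p *\<^sub>R D p u X) (W p)
        = dir_deriv A p u h * g (f p) (X p) (W p) + h p * g (f p) (D p u X) (W p)"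
      using linear_betweenD(2)[OF lin[OF U(3)]
          subspace_scale[OF subspace_tangent_space[OF B] XT]
          subspace_scale[OF subspace_tangent_space[OF B] DX]]
        linear_betweenD(3)[OF lin[OF U(3)] XT] linear_betweenD(3)[OF lin[OF U(3)] DX] by simp
    ultimately show ?thesis
      using \<open>C X\<close> connection_leibniz[OF U(1,3) h X u] linear_betweenD(3)[OF lin' XT]
      by (simp add: C_def algebra_simps)
  qed
  let ?E = "\<lambda>b q. coord_vec B d b (f q)" and ?v = "\<lambda>b q. coord (V q) d \<bullet> b"
  have Es: "smooth_section A B f U (?E b)" for b
    by (rule smooth_section_subset[OF A B f smooth_section_coord_vec[OF A B f d] U(2)])
  have vs: "smooth_fun A U (?v b)" for b
    by (rule smooth_fun_coord[OF A B f U(1,2) V d])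
  have "C (\<lambda>q. \<Sum>b\<in>I. ?v b q *\<^sub>R ?E b q)" if "finite I" "I \<subseteq> Basis" for I
    using that
  proof (induction I rule: finite_induct)
    case empty
    have "dir_deriv A p u (\<lambda>q. g (f q) 0 (W q)) = dir_deriv A p u (\<lambda>_. 0)"
      by (rule dir_deriv_cong[OF A U(1,3) smooth_fun_const[OF A U(1)]])
        (use linear_betweenD(3)[OF lin, of _ 0 0] subspace_0[OF subspace_tangent_space[OF B]] in auto)
    then show ?case
      using linear_betweenD(3)[OF lin[OF U(3)], of 0 0] linear_betweenD(3)[OF lin', of 0 0]
        subspace_0[OF subspace_tangent_space[OF B]] connection_zero[OF u]
      by (simp add: C_def dir_deriv_const[OF A])
  next
    case (insert b I)
    then have "C (\<lambda>q. ?v b q *\<^sub>R ?E b q + (\<Sum>b\<in>I. ?v b q *\<^sub>R ?E b q))"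
      using E[of b] by (intro C_add C_scale smooth_section_sum[OF A B f U(1)]
          smooth_section_scaleR[OF A B f U(1)] Es vs) (auto simp: C_def)
    then show ?case using insert by simp
  qed
  then have "C (\<lambda>q. \<Sum>b\<in>Basis. ?v b q *\<^sub>R ?E b q)" by simp
  then have "C V"
  proof (rule C_cong)
    show "smooth_section A B f U (\<lambda>q. \<Sum>b\<in>Basis. ?v b q *\<^sub>R ?E b q)"
      by (intro smooth_section_sum[OF A B f U(1)] smooth_section_scaleR[OF A B f U(1)] Es vs)
    fix q assume q: "q \<in> U"
    then show "(\<Sum>b\<in>Basis. ?v b q *\<^sub>R ?E b q) = V q"
      using coord_vec_expansion[OF B smooth_sectionD[OF V q], of d] U(2) d
      by (auto simp: charts_at_def)
  qed
  then show ?thesis by (simp add: C_def)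
qed

end

text \<open>For two coordinate fields the identity is that of \<open>N\<close>, moved to
  \<open>p\<close> by the chain rule. The two slots are then freed one after the other by the frame
  reduction.\<close>

lemma pullback_metric_compat:
  assumes N: "levi_civita B g N" and g: "riemannian_metric B g"
    and pb: "pullback_connection A B f N D" and U: "open U" "p \<in> U" and u: "u \<in> tangent_space A p"
    and V: "smooth_section A B f U V" and W: "smooth_section A B f U W"
  shows "dir_deriv A p u (\<lambda>q. g (f q) (V q) (W q))
    = g (f p) (D p u V) (W p) + g (f p) (V p) (D p u W)"
proof -
  have D: "connection_along A B f D"
    using pb by (simp add: pullback_connection_def)
  obtain d where d: "d \<in> B" "f p \<in> fst d"
    using ex_chart[OF B] charts_atD by metis
  let ?U = "U \<inter> f -` fst d" and ?E = "\<lambda>b q. coord_vec B d b (f q)"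
  have U': "open ?U" "?U \<subseteq> f -` fst d" "p \<in> ?U"
    using U d open_vimage_smooth_map[OF A B f open_chart_domain[OF B d(1)]] by (auto intro: open_Int)
  have s: "smooth_section A B f ?U V" "smooth_section A B f ?U W" "smooth_section A B f ?U (?E b)" for b
    using smooth_section_subset[OF A B f V] smooth_section_subset[OF A B f W]
      smooth_section_subset[OF A B f smooth_section_coord_vec[OF A B f d(1)]] by auto
  have EE: "dir_deriv A p u (\<lambda>q. g (f q) (?E a q) (?E b q))
      = g (f p) (D p u (?E a)) (?E b p) + g (f p) (?E a p) (D p u (?E b))" for a b
  proof -
    have op: "open (fst d)" using open_chart_domain[OF B d(1)] .
    have sf: "smooth_field B (fst d) (coord_vec B d b)" for b
      using smooth_field_coord_vec[OF B d(1)] .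
    have df: "differential A B f p u \<in> tangent_space B (f p)"
      using differential_in_tangent_space[OF A B f u] .
    have DE: "D p u (?E b) = N (f p) (differential A B f p u) (coord_vec B d b)" for b
      using pb u op d(2) sf[of b] unfolding pullback_connection_def o_def by blast
    have "dir_deriv A p u (\<lambda>q. g (f q) (?E a q) (?E b q)) = dir_deriv B (f p) (differential A B f p u)
        (\<lambda>q. g q (coord_vec B d a q) (coord_vec B d b q))"
      by (rule dir_deriv_compose[OF op d(2) smooth_fun_metric_fields[OF B g op sf sf]])
    then show ?thesis
      using N df op d(2) sf[of a] sf[of b] unfolding levi_civita_def DE by simp
  qed
  \<comment> \<open>The frame reduction generalises only the first slot; symmetry exchanges the
    slots between its two applications.\<close>
  have sym: "dir_deriv A p u (\<lambda>q. g (f q) (X q) (Y q)) = dir_deriv A p u (\<lambda>q. g (f q) (Y q) (X q))"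
      "g (f p) (D p u X) (Y p) = g (f p) (Y p) (D p u X)"
    if X: "smooth_section A B f ?U X" and Y: "smooth_section A B f ?U Y" for X Y
    using dir_deriv_cong[OF A U'(1,3) smooth_fun_metric[OF B g A f U'(1) Y X], of "\<lambda>q. g (f q) (X q) (Y q)"]
      metric_sym[OF B g] smooth_sectionD[OF X] smooth_sectionD[OF Y] U'(3)
      connection_in_tangent_space[OF D U'(1,3) X u] by simp_all
  have EW: "dir_deriv A p u (\<lambda>q. g (f q) (?E a q) (W q))
      = g (f p) (D p u (?E a)) (W p) + g (f p) (?E a p) (D p u W)" for a
  proof -
    have "dir_deriv A p u (\<lambda>q. g (f q) (W q) (?E a q))
        = g (f p) (D p u W) (?E a p) + g (f p) (W p) (D p u (?E a))"
      by (rule metric_compat_from_frame[OF D g d(1) U' u s(2,3) EE])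
    then show ?thesis
      using sym(2)[OF s(2) s(3)[of a]] sym[OF s(3)[of a] s(2)] by linarith
  qed
  show ?thesis
    by (rule metric_compat_from_frame[OF D g d(1) U' u s(1,2) EW])
qed

end


section \<open>The adjointness of the two covariant derivatives\<close>

context
  fixes A :: "('m::{t2_space, second_countable_topology}, 'a::euclidean_space) chart set"
    and B :: "('n::{t2_space, second_countable_topology}, 'b::euclidean_space) chart set"
    and f :: "'m \<Rightarrow> 'n"
    and gM :: "'m \<Rightarrow> ('m, 'a) tvec \<Rightarrow> ('m, 'a) tvec \<Rightarrow> real"
    and \<phi> :: "'n \<Rightarrow> ('n, 'b) tvec \<Rightarrow> ('n, 'b) tvec"
    and \<xi> :: "'n \<Rightarrow> ('n, 'b) tvec"
    and \<eta> :: "'n \<Rightarrow> ('n, 'b) tvec \<Rightarrow> real"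
    and g :: "'n \<Rightarrow> ('n, 'b) tvec \<Rightarrow> ('n, 'b) tvec \<Rightarrow> real"
  assumes A: "smooth_atlas A" and B: "smooth_atlas B"
    and ac: "almost_contact_metric B \<phi> \<xi> \<eta> g"
    and gM: "riemannian_metric A gM" and iso: "isometric_immersion A B f gM g"
begin

lemma almost_contact_metric_riemannian: "riemannian_metric B g"
  using ac by (simp add: almost_contact_metric_def)

lemmas phi_g = almost_contact_metric_riemannian
  and phi_f = immersion_smooth_map[OF A B gM almost_contact_metric_riemannian iso]

lemma phi_linear: "linear_between (tangent_space B p) (tangent_space B p) (\<phi> p)"
  using ac by (simp add: almost_contact_metric_def)

text \<open>Apply compatibility of \<phi> with the metric to \<open>X\<close> and
  \<open>\<phi> p Y\<close>, where \<eta> vanishes on the second. Expanding the square of \<phi>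
  leaves - Y and a multiple of \<xi>, which is orthogonal to the image of \<phi>.\<close>

lemma phi_skew:
  assumes X: "X \<in> tangent_space B p" and Y: "Y \<in> tangent_space B p"
  shows "g p (\<phi> p X) Y = - g p X (\<phi> p Y)"
proof -
  have pX: "\<phi> p X \<in> tangent_space B p" and pY: "\<phi> p Y \<in> tangent_space B p"
    using linear_betweenD(1)[OF phi_linear] X Y by auto
  have \<xi>: "\<xi> p \<in> tangent_space B p"
    using ac smooth_sectionD[of B B id UNIV \<xi> p] by (simp add: almost_contact_metric_def)
  have ac': "\<phi> p (\<phi> p u) = - u + \<eta> p u *\<^sub>R \<xi> p \<and> \<eta> p (\<phi> p u) = 0 \<and> \<eta> p u = g p u (\<xi> p)"
    if "u \<in> tangent_space B p" for u
    using ac that unfolding almost_contact_metric_def by blast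
  have 1: "\<phi> p (\<phi> p Y) = \<eta> p Y *\<^sub>R \<xi> p - Y" "\<eta> p (\<phi> p Y) = 0" "g p (\<phi> p X) (\<xi> p) = 0"
    using ac'[OF X] ac'[OF Y] ac'[OF pX] by auto
  have "g p X (\<phi> p Y) = g p (\<phi> p X) (\<phi> p (\<phi> p Y))"
    using ac X pY 1(2) by (simp add: almost_contact_metric_def)
  also have "\<dots> = g p (\<phi> p X) (\<eta> p Y *\<^sub>R \<xi> p) - g p (\<phi> p X) Y"
    unfolding 1(1)
    by (rule linear_between_diff[OF metric_linear_right[OF B phi_g pX] subspace_tangent_space[OF B]
          subspace_scale[OF subspace_tangent_space[OF B] \<xi>] Y])
  also have "g p (\<phi> p X) (\<eta> p Y *\<^sub>R \<xi> p) = 0"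
    using linear_betweenD(3)[OF metric_linear_right[OF B phi_g pX] \<xi>] 1(3) by simp
  finally show ?thesis by simp
qed

lemma smooth_section_phi:
  assumes U: "open U" and W: "smooth_section A B f U W"
  shows "smooth_section A B f U (\<lambda>q. \<phi> (f q) (W q))"
proof (rule smooth_section_apply_linear[OF A B phi_f phi_linear U W])
  fix d :: "('n, 'b) chart" and y assume d: "d \<in> B"
  have "smooth_field B (fst d) (\<lambda>q. \<phi> q (coord_vec B d y q))"
    using ac open_chart_domain[OF B d] smooth_field_coord_vec[OF B d]
    by (simp add: almost_contact_metric_def)
  from smooth_section_compose[OF A B phi_f open_chart_domain[OF B d] this]
  show "smooth_section A B f (U \<inter> f -` fst d) (\<lambda>q. \<phi> (f q) (coord_vec B d y (f q)))"
    by (rule smooth_section_subset[OF A B phi_f]) auto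
qed

text \<open>\<open>F_op\<close> and \<open>B_op\<close> are the off-diagonal blocks of \<phi> in the
  splitting into tangent and normal vectors. Both sides use the ambient metric, so that the identity
  can be differentiated with the pull-back connection.\<close>

lemma metric_F_op_B_op:
  assumes u: "u \<in> tangent_space A p" and w: "w \<in> normal_space A B f g p"
  shows "g (f p) (F_op A B f \<phi> g p u) w
    = - g (f p) (differential A B f p u) (differential A B f p (B_op A B f \<phi> g p w))"
proof -
  have wT: "w \<in> tangent_space B (f p)" using w by (simp add: normal_space_def)
  have du: "differential A B f p u \<in> tangent_space B (f p)"
    using differential_in_tangent_space[OF A B phi_f u] .
  have \<phi>T: "\<phi> (f p) v \<in> tangent_space B (f p)" if "v \<in> tangent_space B (f p)" for v
    using linear_betweenD(1)[OF phi_linear that] .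
  note split = A B gM phi_g iso
  have bT: "B_op A B f \<phi> g p w \<in> tangent_space A p"
    unfolding B_op_def using tan_part_in_tangent_space[OF split \<phi>T[OF wT]] .
  have "g (f p) (F_op A B f \<phi> g p u) w = g (f p) (\<phi> (f p) (differential A B f p u)) w"
    unfolding F_op_def by (rule metric_nor_part[OF split \<phi>T[OF du] w])
  also have "\<dots> = - g (f p) (differential A B f p u) (\<phi> (f p) w)"
    by (rule phi_skew[OF du wT])
  also have "g (f p) (differential A B f p u) (\<phi> (f p) w) = g (f p) (\<phi> (f p) w) (differential A B f p u)"
    by (rule metric_sym[OF B phi_g du \<phi>T[OF wT]])
  also have "\<dots> = gM p (B_op A B f \<phi> g p w) u"
    unfolding B_op_def by (rule metric_tan_part[OF split \<phi>T[OF wT] u, symmetric])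
  also have "\<dots> = g (f p) (differential A B f p u) (differential A B f p (B_op A B f \<phi> g p w))"
    using df_isometric[OF split u bT] metric_sym[OF A gM bT u] by simp
  finally show ?thesis .
qed

text \<open>Differentiate \<open>g (F Z, W) + g (Z, B W) = 0\<close>.\<close>

lemma metric_covariant_F_B:
  fixes D :: "'m \<Rightarrow> ('m, 'a) tvec \<Rightarrow> ('m \<Rightarrow> ('n, 'b) tvec) \<Rightarrow> ('n, 'b) tvec"
  assumes N: "levi_civita B g N" and pb: "pullback_connection A B f N D"
    and z: "z \<in> tangent_space A p"
    and Z: "smooth_field A UNIV Z" and W: "normal_section A B f g W"
  shows "g (f p) (normal_connection A B f g D p z (\<lambda>q. F_op A B f \<phi> g q (Z q))
        - F_op A B f \<phi> g p (induced_connection A B f g D p z Z)) (W p)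
    = - gM p (Z p) (induced_connection A B f g D p z (\<lambda>q. B_op A B f \<phi> g q (W q))
        - B_op A B f \<phi> g p (normal_connection A B f g D p z W))"
proof -
  note split = A B gM phi_g iso
  have D: "connection_along A B f D"
    using pb by (simp add: pullback_connection_def)
  let ?d = "differential A B f" and ?F = "F_op A B f \<phi> g" and ?B = "B_op A B f \<phi> g"
  let ?g = "g (f p)" and ?TB = "tangent_space B (f p)" and ?TA = "tangent_space A p"
  have Ws: "smooth_section A B f UNIV W" and Wn: "\<And>q. W q \<in> normal_space A B f g q"
    using W by (auto simp: normal_section_def)
  have WT: "W q \<in> tangent_space B (f q)" for q using Wn[of q] by (simp add: normal_space_def)
  have ZT: "Z q \<in> tangent_space A q" for q using smooth_sectionD[OF Z, of q] by simp
  have dZ: "smooth_section A B f UNIV (\<lambda>q. ?d q (Z q))"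
    by (rule smooth_section_differential[OF A B phi_f open_UNIV Z])
  have FZ: "smooth_section A B f UNIV (\<lambda>q. ?F q (Z q))"
    unfolding F_op_def
    by (intro smooth_section_nor_part[OF split open_UNIV] smooth_section_phi open_UNIV dZ)
  have BW: "smooth_field A UNIV (\<lambda>q. ?B q (W q))"
    unfolding B_op_def
    by (intro smooth_field_tan_part[OF split open_UNIV] smooth_section_phi open_UNIV Ws)
  have BWT: "?B q (W q) \<in> tangent_space A q" for q
    using smooth_sectionD[OF BW, of q] by simp
  have dBW: "smooth_section A B f UNIV (\<lambda>q. ?d q (?B q (W q)))"
    by (rule smooth_section_differential[OF A B phi_f open_UNIV BW])
  note compat = pullback_metric_compat[OF A B phi_f N phi_g pb open_UNIV UNIV_I z]
    and DT = connection_in_tangent_space[OF A B phi_f D open_UNIV UNIV_I _ z]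
    and smg = smooth_fun_metric[OF B phi_g A phi_f open_UNIV]
    and dT = differential_in_tangent_space[OF A B phi_f]
  define a where "a = D p z (\<lambda>q. ?F q (Z q))"
  define b where "b = D p z W"
  define c where "c = D p z (\<lambda>q. ?d q (Z q))"
  define e where "e = D p z (\<lambda>q. ?d q (?B q (W q)))"
  have T: "a \<in> ?TB" "b \<in> ?TB" "c \<in> ?TB" "e \<in> ?TB"
    unfolding a_def b_def c_def e_def using DT FZ Ws dZ dBW by blast+
  have "dir_deriv A p z (\<lambda>q. g (f q) (?F q (Z q)) (W q))
      + dir_deriv A p z (\<lambda>q. g (f q) (?d q (Z q)) (?d q (?B q (W q))))
      = dir_deriv A p z (\<lambda>q. g (f q) (?F q (Z q)) (W q) + g (f q) (?d q (Z q)) (?d q (?B q (W q))))"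
    by (rule dir_deriv_add[OF A UNIV_I smg[OF FZ Ws] smg[OF dZ dBW], symmetric])
  also have "\<dots> = 0"
    using metric_F_op_B_op[OF ZT Wn] dir_deriv_const[OF A] by simp
  finally have main: "?g a (W p) + ?g (?F p (Z p)) b + (?g c (?d p (?B p (W p))) + ?g (?d p (Z p)) e) = 0"
    unfolding compat[OF FZ Ws] compat[OF dZ dBW] a_def b_def c_def e_def .
  \<comment> \<open>The four terms of \<open>main\<close> regroup: those with \<open>a\<close> and
    \<open>c\<close> make up the covariant derivative of F tested against \<open>W p\<close>, those
    with \<open>e\<close> and \<open>b\<close> that of B tested against \<open>Z p\<close>. The
    components dropped by the projections are orthogonal to the test vectors.\<close>
  let ?tc = "tan_part A B f g p c" and ?te = "tan_part A B f g p e" and ?nb = "nor_part A B f g p b"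
  have tT: "?tc \<in> ?TA" "?te \<in> ?TA" and nbn: "?nb \<in> normal_space A B f g p"
    and nan: "nor_part A B f g p a \<in> normal_space A B f g p"
    using tan_part_in_tangent_space[OF split] nor_part_in_normal_space[OF split] T by auto
  have FT: "?F p u \<in> normal_space A B f g p" if "u \<in> ?TA" for u
    unfolding F_op_def
    using nor_part_in_normal_space[OF split linear_betweenD(1)[OF phi_linear dT[OF that]]] .
  have BT: "?B p w \<in> ?TA" if "w \<in> ?TB" for w
    unfolding B_op_def using tan_part_in_tangent_space[OF split linear_betweenD(1)[OF phi_linear that]] .
  have nT: "w \<in> ?TB" if "w \<in> normal_space A B f g p" for w
    using that by (simp add: normal_space_def)
  have "?g (nor_part A B f g p a - ?F p ?tc) (W p) = ?g a (W p) - ?g (?F p ?tc) (W p)"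
    using linear_between_diff[OF metric_linear_left[OF B phi_g WT] subspace_tangent_space[OF B]
        nT[OF nan] nT[OF FT[OF tT(1)]]] metric_nor_part[OF split T(1) Wn] by simp
  also have "?g (?F p ?tc) (W p) = - gM p ?tc (?B p (W p))"
    using metric_F_op_B_op[OF tT(1) Wn] df_isometric[OF split tT(1) BWT] by simp
  also have "gM p ?tc (?B p (W p)) = ?g c (?d p (?B p (W p)))"
    by (rule metric_tan_part[OF split T(3) BWT])
  finally have left: "?g (nor_part A B f g p a - ?F p ?tc) (W p)
      = ?g a (W p) + ?g c (?d p (?B p (W p)))" by simp
  have "gM p (Z p) (?te - ?B p ?nb) = gM p (Z p) ?te - gM p (Z p) (?B p ?nb)"
    by (rule linear_between_diff[OF metric_linear_right[OF A gM ZT] subspace_tangent_space[OF A]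
          tT(2) BT[OF nT[OF nbn]]])
  also have "gM p (Z p) ?te = ?g (?d p (Z p)) e"
    using metric_sym[OF A gM ZT tT(2)] metric_tan_part[OF split T(4) ZT]
      metric_sym[OF B phi_g T(4) dT[OF ZT]] by simp
  also have "gM p (Z p) (?B p ?nb) = - ?g (?F p (Z p)) ?nb"
    using metric_F_op_B_op[OF ZT nbn] df_isometric[OF split ZT BT[OF nT[OF nbn]]] by simp
  also have "?g (?F p (Z p)) ?nb = ?g (?F p (Z p)) b"
    using metric_nor_part[OF split T(2) FT[OF ZT]] metric_sym[OF B phi_g nT[OF FT[OF ZT]]]
      T(2) nT[OF nbn] by simp
  finally have right: "gM p (Z p) (?te - ?B p ?nb) = ?g (?d p (Z p)) e + ?g (?F p (Z p)) b" by simp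
  show ?thesis
    using left right main
    by (simp add: normal_connection_def induced_connection_def a_def b_def c_def e_def)
qed

text \<open>The test field is chosen to take at \<open>p\<close> the very value that is to vanish;
  the adjointness relation then says that its squared length is zero.\<close>

lemma F_parallel_iff_B_parallel:
  fixes D :: "'m \<Rightarrow> ('m, 'a) tvec \<Rightarrow> ('m \<Rightarrow> ('n, 'b) tvec) \<Rightarrow> ('n, 'b) tvec"
  assumes N: "levi_civita B g N" and pb: "pullback_connection A B f N D"
  shows "F_parallel A B f \<phi> g D \<longleftrightarrow> B_parallel A B f \<phi> g D"
proof -
  note split = A B gM phi_g iso
  have D: "connection_along A B f D"
    using pb by (simp add: pullback_connection_def)
  have FT: "F_op A B f \<phi> g p u \<in> normal_space A B f g p" if "u \<in> tangent_space A p" for p u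
    unfolding F_op_def
    using nor_part_in_normal_space[OF split] linear_betweenD(1)[OF phi_linear]
      differential_in_tangent_space[OF A B phi_f that] by blast
  have BT: "B_op A B f \<phi> g p w \<in> tangent_space A p" if "w \<in> normal_space A B f g p" for p w
    unfolding B_op_def
    using tan_part_in_tangent_space[OF split] linear_betweenD(1)[OF phi_linear] that
    by (simp add: normal_space_def)
  have DT: "D p z W \<in> tangent_space B (f p)"
    if "smooth_section A B f UNIV W" "z \<in> tangent_space A p" for p z W
    using connection_in_tangent_space[OF A B phi_f D open_UNIV UNIV_I that] .
  have Zs: "smooth_section A B f UNIV (\<lambda>q. differential A B f q (Z q))" if "smooth_field A UNIV Z" for Z
    by (rule smooth_section_differential[OF A B phi_f open_UNIV that])
  have zT: "Z p \<in> tangent_space A p" if "smooth_field A UNIV Z" for Z p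
    using smooth_sectionD[OF that, of p] by simp
  have FZ: "smooth_section A B f UNIV (\<lambda>q. F_op A B f \<phi> g q (Z q))" if "smooth_field A UNIV Z" for Z
    unfolding F_op_def
    by (intro smooth_section_nor_part[OF split open_UNIV] smooth_section_phi open_UNIV Zs that)
  have BW: "smooth_field A UNIV (\<lambda>q. B_op A B f \<phi> g q (W q))" if "normal_section A B f g W" for W
    unfolding B_op_def using that
    by (intro smooth_field_tan_part[OF split open_UNIV] smooth_section_phi open_UNIV)
      (simp add: normal_section_def)
  let ?P = "\<lambda>Z Z' p. normal_connection A B f g D p (Z p) (\<lambda>q. F_op A B f \<phi> g q (Z' q))
    - F_op A B f \<phi> g p (induced_connection A B f g D p (Z p) Z')"
  let ?Q = "\<lambda>Z W p. induced_connection A B f g D p (Z p) (\<lambda>q. B_op A B f \<phi> g q (W q))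
    - B_op A B f \<phi> g p (normal_connection A B f g D p (Z p) W)"
  \<comment> \<open>With its counterpart for \<open>?Q\<close>, this ensures that the values lie on
    the right side of the splitting to be used as test vectors.\<close>
  have P: "?P Z Z' p \<in> normal_space A B f g p"
    if "smooth_field A UNIV Z" "smooth_field A UNIV Z'" for Z Z' p
  proof -
    have "subspace (normal_space A B f g p)"
      by (rule subspace_normal_space[OF split])
    then show ?thesis
      unfolding normal_connection_def induced_connection_def
      by (intro subspace_diff nor_part_in_normal_space[OF split] FT tan_part_in_tangent_space[OF split]
          DT FZ Zs zT that)
  qed
  have Q: "?Q Z W p \<in> tangent_space A p"
    if "smooth_field A UNIV Z" "normal_section A B f g W" for Z W p
    unfolding normal_connection_def induced_connection_def
    using that(2)
    by (intro subspace_diff[OF subspace_tangent_space[OF A]] nor_part_in_normal_space[OF split] BT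
        tan_part_in_tangent_space[OF split] DT Zs BW zT that) (simp add: normal_section_def)
  have adj: "g (f p) (?P Z Z' p) (W p) = - gM p (Z' p) (?Q Z W p)"
    if "smooth_field A UNIV Z" "smooth_field A UNIV Z'" "normal_section A B f g W" for Z Z' W p
    using metric_covariant_F_B[OF N pb zT[OF that(1)] that(2,3)] .
  show ?thesis
  proof
    assume F: "F_parallel A B f \<phi> g D"
    show "B_parallel A B f \<phi> g D"
      unfolding B_parallel_def
    proof (intro allI impI; elim conjE)
      fix Z W p assume Z: "smooth_field A UNIV Z" and W: "normal_section A B f g W"
      \<comment> \<open>Vector fields are sections along the identity, so the extension result is
        applied with \<open>id\<close> in place of \<open>f\<close>.\<close>
      have "?Q Z W p \<in> tangent_space A (id p)"
        using Q[OF Z W] by simp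
      then obtain Z' where Z': "smooth_field A UNIV Z'" "Z' p = ?Q Z W p"
        by (rule extend_vector[OF A A smooth_map_id[OF A]])
      have WT: "W p \<in> tangent_space B (f p)"
        using W by (simp add: normal_section_def normal_space_def)
      have "?P Z Z' p = 0"
        using F Z Z'(1) by (simp add: F_parallel_def)
      then have "gM p (?Q Z W p) (?Q Z W p) = 0"
        using adj[OF Z Z'(1) W, of p] Z'(2)
          linear_betweenD(3)[OF metric_linear_left[OF B phi_g WT] WT, of 0] by simp
      then show "?Q Z W p = 0"
        by (rule metric_eq_zeroD[OF A gM Q[OF Z W]])
    qed
  next
    assume Bp: "B_parallel A B f \<phi> g D"
    show "F_parallel A B f \<phi> g D"
      unfolding F_parallel_def
    proof (intro allI impI; elim conjE)
      fix Z Z' p assume Z: "smooth_field A UNIV Z" and Z': "smooth_field A UNIV Z'"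
      obtain W where W: "normal_section A B f g W" "W p = ?P Z Z' p"
        by (rule extend_normal_vector[OF split P[OF Z Z']])
      have "?Q Z W p = 0"
        using Bp Z W(1) by (simp add: B_parallel_def)
      then have "g (f p) (?P Z Z' p) (?P Z Z' p) = 0"
        using adj[OF Z Z' W(1), of p] W(2)
          linear_betweenD(3)[OF metric_linear_right[OF A gM zT[OF Z', of p]] zT[OF Z', of p], of 0] by simp
      moreover have "?P Z Z' p \<in> tangent_space B (f p)"
        using P[OF Z Z', of p] by (simp add: normal_space_def)
      ultimately show "?P Z Z' p = 0"
        by (intro metric_eq_zeroD[OF B phi_g])
    qed
  qed
qed

end

theorem theorem5p4:
  fixes A :: "('m::{t2_space, second_countable_topology}, 'a::euclidean_space) chart set"
    and B :: "('n::{t2_space, second_countable_topology}, 'b::euclidean_space) chart set"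
    and f :: "'m \<Rightarrow> 'n"
    and gM :: "'m \<Rightarrow> ('m, 'a) tvec \<Rightarrow> ('m, 'a) tvec \<Rightarrow> real"
    and \<phi> :: "'n \<Rightarrow> ('n, 'b) tvec \<Rightarrow> ('n, 'b) tvec"
    and \<xi> :: "'n \<Rightarrow> ('n, 'b) tvec"
    and \<eta> :: "'n \<Rightarrow> ('n, 'b) tvec \<Rightarrow> real"
    and g :: "'n \<Rightarrow> ('n, 'b) tvec \<Rightarrow> ('n, 'b) tvec \<Rightarrow> real"
    and N :: "'n \<Rightarrow> ('n, 'b) tvec \<Rightarrow> ('n \<Rightarrow> ('n, 'b) tvec) \<Rightarrow> ('n, 'b) tvec"
    and D :: "'m \<Rightarrow> ('m, 'a) tvec \<Rightarrow> ('m \<Rightarrow> ('n, 'b) tvec) \<Rightarrow> ('n, 'b) tvec"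
  assumes "smooth_atlas B"
    and "cosymplectic B \<phi> \<xi> \<eta> g N"
    and "smooth_atlas A"
    and "riemannian_metric A gM"
    and "isometric_immersion A B f gM g"
    and "proper_quasi_bi_slant A B f \<phi> \<xi> g"
    and "pullback_connection A B f N D"
  shows "F_parallel A B f \<phi> g D \<longleftrightarrow> B_parallel A B f \<phi> g D"
proof -
  have "almost_contact_metric B \<phi> \<xi> \<eta> g" and "levi_civita B g N"
    using assms(2) by (simp_all add: cosymplectic_def)
  then show ?thesis
    using F_parallel_iff_B_parallel[OF assms(3,1) _ assms(4,5) _ assms(7)] by blast
qed

end
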